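(* Consider the triangular array $Y_{n,k}=\mu+\delta_n\mathbf{1}\{k>\tau_n\}+\sigma(k/n)\varepsilon_k$, $k=1,\dots,n$, and suppose Assumptions E, V and C (stated in the context) hold. Under the alternative hypothesis $\mathcal{H}_1$ with $\tau_n=[n\zeta]$ for some $\zeta\in(0,1)$, the estimator $$\hat\tau_n=\operatorname{argmax}_{1\le k\le n}\frac{\left|\sum_{i=1}^k(Y_{n,i}-\bar Y_{n,1:n})\right|+\left|\sum_{i=n-k+1}^n(Y_{n,i}-\bar Y_{n,1:n})\right|}{\max_{1\le i\le k}\left|\sum_{j=1}^i(Y_{n,j}-\bar Y_{n,1:k})\right|+\max_{k<i\le n}\left|\sum_{j=i}^n(Y_{n,j}-\bar Y_{n,(k+1):n})\right|}$$ satisfies $\hat\tau_n/n\xrightarrow{P}\zeta$ as $n\to\infty$.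
   Context: Model: $Y_{n,k}=\mu+\delta_n\mathbf{1}\{k>\tau_n\}+\sigma(k/n)\varepsilon_k$, $k=1,\dots,n$, with unknown $\mu,\delta_n\in\mathbb{R}$, $\tau_n\in\{1,\dots,n\}$, strictly stationary centered $\{\varepsilon_k\}$, deterministic $\sigma:[0,1]\to(0,\infty)$. $\mathcal{H}_1:\tau_n<n,\ \delta_n\ne0$. $\bar Y_{n,i:j}=\frac1{j-i+1}\sum_{k=i}^jY_{n,k}$; $[x]$ is the integer part. Strong mixing coefficients: $\alpha(n)=\sup_k\sup_{A\in\sigma(\varepsilon_1,\dots,\varepsilon_k),B\in\sigma(\varepsilon_{k+n},\dots)}|P(A\cap B)-P(A)P(B)|$. Assumption E: $\{\varepsilon_n\}$ zero-mean strictly stationary $\alpha$-mixing, $\operatorname{Var}\varepsilon_n=1$, $E|\varepsilon_n|^p<\infty$ for some $p>2$, $\sum_n\alpha(n)^{2(1/r-1/p)}<\infty$ for some $r\in(2,4]$, $r\le p$, $\sum_nn\alpha(n)<\infty$, and $0<1+2\sum_{n\ge1}E\varepsilon_1\varepsilon_{n+1}<\infty$. Assumption V: $\sigma:[0,1]\to\mathbb{R}^+$ has finitely many discontinuity points and satisfies a first-order Lipschitz condition except at discontinuity points. Assumption C: $|\delta_n|\sqrt n\to\infty$. *)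

theory Defs
  imports "HOL-Probability.Probability"
begin

definition gen_sigma :: "'a measure \<Rightarrow> (nat \<Rightarrow> 'a \<Rightarrow> real) \<Rightarrow> nat set \<Rightarrow> 'a set set" where
  "gen_sigma M X I = sigma_sets (space M) {X i -` A \<inter> space M | i A. i \<in> I \<and> A \<in> sets borel}"

definition alpha_coef :: "'a measure \<Rightarrow> (nat \<Rightarrow> 'a \<Rightarrow> real) \<Rightarrow> nat \<Rightarrow> real" where
  "alpha_coef M X n = (SUP k\<in>{1..}. SUP A\<in>gen_sigma M X {1..k}. SUP B\<in>gen_sigma M X {k+n..}.
      \<bar>measure M (A \<inter> B) - measure M A * measure M B\<bar>)"

definition strictly_stationary :: "'a measure \<Rightarrow> (nat \<Rightarrow> 'a \<Rightarrow> real) \<Rightarrow> bool" where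
  "strictly_stationary M X \<longleftrightarrow> (\<forall>h m.
     distr M (PiM {..<m} (\<lambda>_. borel)) (\<lambda>\<omega>. \<lambda>i\<in>{..<m}. X (i + 1 + h) \<omega>) =
     distr M (PiM {..<m} (\<lambda>_. borel)) (\<lambda>\<omega>. \<lambda>i\<in>{..<m}. X (i + 1) \<omega>))"

(* x^a for x \<ge> 0 with the convention x^0 = 1 (Isabelle has 0 powr 0 = 0) *)
definition rpow :: "real \<Rightarrow> real \<Rightarrow> real" where
  "rpow x a = (if a = 0 then 1 else x powr a)"

definition assumption_E :: "'a measure \<Rightarrow> (nat \<Rightarrow> 'a \<Rightarrow> real) \<Rightarrow> bool" where
  "assumption_E M \<epsilon> \<longleftrightarrow>
     (\<forall>k\<ge>1. \<epsilon> k \<in> borel_measurable M) \<and>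
     strictly_stationary M \<epsilon> \<and>
     integrable M (\<epsilon> 1) \<and> prob_space.expectation M (\<epsilon> 1) = 0 \<and>
     integrable M (\<lambda>\<omega>. (\<epsilon> 1 \<omega>)\<^sup>2) \<and> prob_space.variance M (\<epsilon> 1) = 1 \<and>
     (\<exists>p>2. integrable M (\<lambda>\<omega>. \<bar>\<epsilon> 1 \<omega>\<bar> powr p) \<and>
        (\<exists>r. 2 < r \<and> r \<le> 4 \<and> r \<le> p \<and>
           summable (\<lambda>n. rpow (alpha_coef M \<epsilon> (Suc n)) (2 * (1/r - 1/p))))) \<and>
     summable (\<lambda>n. real (Suc n) * alpha_coef M \<epsilon> (Suc n)) \<and>
     summable (\<lambda>n. prob_space.expectation M (\<lambda>\<omega>. \<epsilon> 1 \<omega> * \<epsilon> (n + 2) \<omega>)) \<and>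
     0 < 1 + 2 * (\<Sum>n. prob_space.expectation M (\<lambda>\<omega>. \<epsilon> 1 \<omega> * \<epsilon> (n + 2) \<omega>))"

definition assumption_V :: "(real \<Rightarrow> real) \<Rightarrow> bool" where
  "assumption_V \<sigma> \<longleftrightarrow>
     (\<forall>x\<in>{0..1}. 0 < \<sigma> x) \<and>
     (\<exists>D L. finite D \<and> D \<subseteq> {0..1} \<and>
        (\<forall>x\<in>{0..1}. \<forall>y\<in>{0..1}. D \<inter> {min x y..max x y} = {} \<longrightarrow>
            \<bar>\<sigma> x - \<sigma> y\<bar> \<le> L * \<bar>x - y\<bar>))"

definition obsY :: "real \<Rightarrow> (nat \<Rightarrow> real) \<Rightarrow> (nat \<Rightarrow> nat) \<Rightarrow> (real \<Rightarrow> real) \<Rightarrow> (nat \<Rightarrow> 'a \<Rightarrow> real)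
    \<Rightarrow> nat \<Rightarrow> nat \<Rightarrow> 'a \<Rightarrow> real" where
  "obsY \<mu> \<delta> \<tau> \<sigma> \<epsilon> n k \<omega> = \<mu> + \<delta> n * (if k > \<tau> n then 1 else 0) + \<sigma> (real k / real n) * \<epsilon> k \<omega>"

definition blk_mean :: "(nat \<Rightarrow> real) \<Rightarrow> nat \<Rightarrow> nat \<Rightarrow> real" where
  "blk_mean y i j = (\<Sum>k=i..j. y k) / (real j - real i + 1)"

(* the ratio statistic at candidate k for sample y_1..y_n; Max over an empty range is 0 *)
definition ratio_stat :: "(nat \<Rightarrow> real) \<Rightarrow> nat \<Rightarrow> nat \<Rightarrow> real" where
  "ratio_stat y n k =
     (\<bar>\<Sum>i=1..k. y i - blk_mean y 1 n\<bar> + \<bar>\<Sum>i=n-k+1..n. y i - blk_mean y 1 n\<bar>) /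
     (Max (insert 0 {\<bar>\<Sum>j=1..i. y j - blk_mean y 1 k\<bar> | i. i \<in> {1..k}}) +
      Max (insert 0 {\<bar>\<Sum>j=i..n. y j - blk_mean y (k+1) n\<bar> | i. i \<in> {k<..n}}))"

definition tau_hat :: "(nat \<Rightarrow> real) \<Rightarrow> nat \<Rightarrow> nat" where
  "tau_hat y n = (LEAST k. k \<in> {1..n} \<and> (\<forall>j\<in>{1..n}. ratio_stat y n j \<le> ratio_stat y n k))"

end

theory Submission
  imports Defs
begin

text \<open>Let \<open>S k\<close> and \<open>W k\<close> be the partial sums of \<open>\<epsilon> i\<close> and of \<open>\<sigma> (i / n) * \<epsilon> i\<close>. If \<open>\<bar>W k\<bar> \<le> \<eta> n \<bar>\<delta> n\<bar>\<close> for
  all \<open>k \<le> n\<close>, then the numerator of the statistic is of order \<open>n \<bar>\<delta> n\<bar>\<close> at the true change point and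
  at most of that order elsewhere, while the denominator is at most \<open>6 \<eta> n \<bar>\<delta> n\<bar>\<close> at the change point
  and at least of order \<open>n \<bar>\<delta> n\<bar>\<close> away from it. So for small \<open>\<eta>\<close> the maximum is attained near the
  change point, unless the denominator vanishes there, in which case the quotient is \<open>0\<close>; this
  forces all \<open>\<epsilon> i\<close> before the change to have the same sign, which mixing makes improbable.

  As \<open>\<sigma>\<close> has bounded variation, summation by parts bounds \<open>max \<bar>W k\<bar>\<close> by a constant times \<open>max \<bar>S k\<bar>\<close>,
  and it remains to show that \<open>max \<bar>S k\<bar>\<close> is \<open>O(sqrt n)\<close> in probability. Summability of the
  covariances gives second moments of \<open>S k\<close> of order \<open>k\<close>. An Ottaviani argument over blocks of length
  \<open>q = n powr a\<close> transfers this to the maximum, with error terms \<open>(n / q) \<alpha>(q)\<close> from mixing and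
  \<open>q powr (p - 1) * n powr (1 - p / 2)\<close> from the crude bound inside the blocks. With
  \<open>s = 2 (1/r - 1/p)\<close>, monotonicity gives \<open>\<alpha>(q) = O(q powr (- 1 / s))\<close>, so both errors vanish if
  \<open>s / (1 + s) < a < (p - 2) / (2 (p - 1))\<close>; this range is nonempty because \<open>s < 1 - 2 / p\<close>.\<close>

section \<open>Moment bounds for stationary processes\<close>

text \<open>Jensen's inequality for the convex power \<open>p\<close>, applied to the average of the
  terms. Zero terms are discarded first, so that convexity is applied to positive values
  only.\<close>

lemma powr_sum_le:
  fixes f :: "'i \<Rightarrow> real"
  assumes S: "finite S" and f: "\<And>i. i \<in> S \<Longrightarrow> 0 \<le> f i" and p: "1 \<le> p"
  shows "(\<Sum>i\<in>S. f i) powr p \<le> real (card S) powr (p - 1) * (\<Sum>i\<in>S. f i powr p)"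
proof -
  let ?T = "{i \<in> S. 0 < f i}"
  have T: "finite ?T" "?T \<subseteq> S" using S by auto
  have f0: "f i = 0" if "i \<in> S - ?T" for i using f[of i] that by auto
  have s1: "(\<Sum>i\<in>S. f i) = (\<Sum>i\<in>?T. f i)"
    using S f0 by (intro sum.mono_neutral_right) auto
  have s2: "(\<Sum>i\<in>S. f i powr p) = (\<Sum>i\<in>?T. f i powr p)"
    using S f0 by (intro sum.mono_neutral_right) auto
  show ?thesis
  proof (cases "?T = {}")
    case True
    show ?thesis unfolding s1 s2 True by simp
  next
    case False
    let ?q = "real (card ?T)"
    have q: "0 < ?q" using T(1) False by (simp add: card_gt_0_iff)
    have nn: "0 \<le> (\<Sum>i\<in>?T. f i powr p)" by (intro sum_nonneg) simp
    have "(\<Sum>i\<in>?T. (1 / ?q) *\<^sub>R f i) powr p \<le> (\<Sum>i\<in>?T. (1 / ?q) * f i powr p)"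
      by (rule convex_on_sum[OF T(1) False powr_convex[OF p]]) (use q in auto)
    then have "((\<Sum>i\<in>?T. f i) / ?q) powr p \<le> (\<Sum>i\<in>?T. f i powr p) / ?q"
      by (simp add: sum_divide_distrib)
    then have "(\<Sum>i\<in>?T. f i) powr p / ?q powr p \<le> (\<Sum>i\<in>?T. f i powr p) / ?q"
      using q by (simp add: powr_divide sum_nonneg)
    then have "(\<Sum>i\<in>?T. f i) powr p \<le> ?q powr (p - 1) * (\<Sum>i\<in>?T. f i powr p)"
      using q by (simp add: field_simps powr_diff)
    also have "\<dots> \<le> real (card S) powr (p - 1) * (\<Sum>i\<in>?T. f i powr p)"
      using p T S nn by (intro mult_right_mono powr_mono2) (auto intro: card_mono)
    finally show ?thesis by (simp only: s1 s2)
  qed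
qed

locale stationary_process = prob_space M for M :: "'a measure" +
  fixes X :: "nat \<Rightarrow> 'a \<Rightarrow> real"
  assumes measurable_X: "1 \<le> k \<Longrightarrow> X k \<in> borel_measurable M"
    and stationary: "strictly_stationary M X"
begin

abbreviation block_sum :: "nat \<Rightarrow> nat \<Rightarrow> 'a \<Rightarrow> real" where
  "block_sum m n \<omega> \<equiv> \<Sum>i\<in>{m<..n}. X i \<omega>"

lemma measurable_block_sum [measurable]: "block_sum m n \<in> borel_measurable M"
  by (intro borel_measurable_sum measurable_X) auto

lemma window_measurable:
  "(\<lambda>\<omega>. \<lambda>i\<in>{..<m}. X (i + 1 + h) \<omega>) \<in> measurable M (PiM {..<m} (\<lambda>_. borel))"
  by (intro measurable_restrict measurable_X) auto

text \<open>Stationarity is an equality of laws of windows of length \<open>m\<close>. Writing a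
  quantity as a function \<open>F\<close> of such a window lets its expectation and integrability be
  moved to the start of the sequence.\<close>

lemma
  fixes F :: "(nat \<Rightarrow> real) \<Rightarrow> real"
  assumes F: "F \<in> borel_measurable (PiM {..<m} (\<lambda>_. borel))"
  shows expectation_shift: "expectation (\<lambda>\<omega>. F (\<lambda>i\<in>{..<m}. X (i + 1 + h) \<omega>)) =
            expectation (\<lambda>\<omega>. F (\<lambda>i\<in>{..<m}. X (i + 1) \<omega>))"
    and integrable_shift: "integrable M (\<lambda>\<omega>. F (\<lambda>i\<in>{..<m}. X (i + 1 + h) \<omega>)) \<longleftrightarrow>
            integrable M (\<lambda>\<omega>. F (\<lambda>i\<in>{..<m}. X (i + 1) \<omega>))"
proof -
  have eq: "distr M (PiM {..<m} (\<lambda>_. borel)) (\<lambda>\<omega>. \<lambda>i\<in>{..<m}. X (i + 1 + h) \<omega>) =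
     distr M (PiM {..<m} (\<lambda>_. borel)) (\<lambda>\<omega>. \<lambda>i\<in>{..<m}. X (i + 1) \<omega>)"
    using stationary unfolding strictly_stationary_def by blast
  note w0 = window_measurable[where m = m and h = 0, simplified add_0_right]
  show "expectation (\<lambda>\<omega>. F (\<lambda>i\<in>{..<m}. X (i + 1 + h) \<omega>)) =
            expectation (\<lambda>\<omega>. F (\<lambda>i\<in>{..<m}. X (i + 1) \<omega>))"
    using integral_distr[OF window_measurable[where h = h] F] integral_distr[OF w0 F] eq by simp
  show "integrable M (\<lambda>\<omega>. F (\<lambda>i\<in>{..<m}. X (i + 1 + h) \<omega>)) \<longleftrightarrow>
            integrable M (\<lambda>\<omega>. F (\<lambda>i\<in>{..<m}. X (i + 1) \<omega>))"
    using integrable_distr_eq[OF window_measurable[where h = h] F] integrable_distr_eq[OF w0 F] eq by simp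
qed

lemma
  fixes f :: "real \<Rightarrow> real"
  assumes f: "f \<in> borel_measurable borel" and k: "1 \<le> k"
  shows expectation_marginal: "expectation (\<lambda>\<omega>. f (X k \<omega>)) = expectation (\<lambda>\<omega>. f (X 1 \<omega>))"
    and integrable_marginal: "integrable M (\<lambda>\<omega>. f (X k \<omega>)) \<longleftrightarrow> integrable M (\<lambda>\<omega>. f (X 1 \<omega>))"
proof -
  have m: "(\<lambda>x. f (x 0)) \<in> borel_measurable (PiM {..<1::nat} (\<lambda>_. borel))"
    using f by measurable
  show "expectation (\<lambda>\<omega>. f (X k \<omega>)) = expectation (\<lambda>\<omega>. f (X 1 \<omega>))"
    using expectation_shift[OF m, of "k - 1"] k by simp
  show "integrable M (\<lambda>\<omega>. f (X k \<omega>)) \<longleftrightarrow> integrable M (\<lambda>\<omega>. f (X 1 \<omega>))"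
    using integrable_shift[OF m, of "k - 1"] k by simp
qed

lemma expectation_product_shift:
  assumes "1 \<le> k"
  shows "expectation (\<lambda>\<omega>. X k \<omega> * X (k + h) \<omega>) = expectation (\<lambda>\<omega>. X 1 \<omega> * X (1 + h) \<omega>)"
proof -
  have m: "(\<lambda>x. x 0 * x h) \<in> borel_measurable (PiM {..<Suc h} (\<lambda>_. borel::real measure))"
    by measurable
  show ?thesis
    using expectation_shift[OF m, of "k - 1"] assms by (simp add: add.commute)
qed

lemma prob_marginal:
  assumes B: "B \<in> sets borel" and k: "1 \<le> k"
  shows "prob {\<omega> \<in> space M. X k \<omega> \<in> B} = prob {\<omega> \<in> space M. X 1 \<omega> \<in> B}"
proof -
  have "prob {\<omega> \<in> space M. X j \<omega> \<in> B} = expectation (\<lambda>\<omega>. indicat_real B (X j \<omega>))" if "1 \<le> j" for j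
  proof -
    have "expectation (\<lambda>\<omega>. indicat_real B (X j \<omega>)) = expectation (indicat_real {\<omega> \<in> space M. X j \<omega> \<in> B})"
      by (intro Bochner_Integration.integral_cong) (auto simp: indicator_def)
    also have "\<dots> = prob ({\<omega> \<in> space M. X j \<omega> \<in> B} \<inter> space M)" by simp
    also have "{\<omega> \<in> space M. X j \<omega> \<in> B} \<inter> space M = {\<omega> \<in> space M. X j \<omega> \<in> B}" by auto
    finally show ?thesis by simp
  qed
  moreover have "indicat_real B \<in> borel_measurable borel" using B by measurable
  ultimately show ?thesis using expectation_marginal[of "indicat_real B" k] k by simp
qed

text \<open>Induction on the right end: a new term adds its own square and twice a cross term, and
  by stationarity the cross term is a partial sum of the covariance series, at most
  \<open>K\<close>. Hence the growth is linear.\<close>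

lemma second_moment_block_sum:
  assumes sq: "integrable M (\<lambda>\<omega>. (X 1 \<omega>)\<^sup>2)"
    and cov: "\<And>n. \<bar>\<Sum>h<n. expectation (\<lambda>\<omega>. X 1 \<omega> * X (h + 2) \<omega>)\<bar> \<le> K"
  shows "integrable M (\<lambda>\<omega>. (block_sum m n \<omega>)\<^sup>2)"
    and "expectation (\<lambda>\<omega>. (block_sum m n \<omega>)\<^sup>2) \<le> (expectation (\<lambda>\<omega>. (X 1 \<omega>)\<^sup>2) + 2 * K) * real n"
proof -
  let ?v = "expectation (\<lambda>\<omega>. (X 1 \<omega>)\<^sup>2)"
  have sqk: "integrable M (\<lambda>\<omega>. (X k \<omega>)\<^sup>2)" "expectation (\<lambda>\<omega>. (X k \<omega>)\<^sup>2) = ?v" if "1 \<le> k" for k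
    using integrable_marginal[of "\<lambda>x. x\<^sup>2" k] expectation_marginal[of "\<lambda>x. x\<^sup>2" k] that sq by auto
  have prod: "integrable M (\<lambda>\<omega>. X i \<omega> * X j \<omega>)" if "1 \<le> i" "1 \<le> j" for i j
  proof (rule Bochner_Integration.integrable_bound)
    show "integrable M (\<lambda>\<omega>. (X i \<omega>)\<^sup>2 + (X j \<omega>)\<^sup>2)" using sqk that by auto
    show "(\<lambda>\<omega>. X i \<omega> * X j \<omega>) \<in> borel_measurable M" using measurable_X that by auto
    have "\<bar>x * y\<bar> \<le> x\<^sup>2 + y\<^sup>2" for x y :: real
      using sum_squares_bound[of x y] sum_squares_bound[of x "- y"] zero_le_power2[of x] zero_le_power2[of y]
      by (simp add: abs_if)
    then show "AE \<omega> in M. norm (X i \<omega> * X j \<omega>) \<le> norm ((X i \<omega>)\<^sup>2 + (X j \<omega>)\<^sup>2)" by simp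
  qed
  have K0: "0 \<le> K" using cov[of 0] by simp
  have v0: "0 \<le> ?v" by simp
  have cross: "expectation (\<lambda>\<omega>. block_sum m n \<omega> * X (Suc n) \<omega>) \<le> K" for n
  proof -
    have "expectation (\<lambda>\<omega>. block_sum m n \<omega> * X (Suc n) \<omega>)
        = (\<Sum>i\<in>{m<..n}. expectation (\<lambda>\<omega>. X i \<omega> * X (Suc n) \<omega>))"
      unfolding sum_distrib_right by (intro Bochner_Integration.integral_sum prod) auto
    also have "\<dots> = (\<Sum>i\<in>{m<..n}. expectation (\<lambda>\<omega>. X 1 \<omega> * X (n - i + 2) \<omega>))"
    proof (rule sum.cong)
      fix i assume i: "i \<in> {m<..n}"
      then have "Suc n = i + (n - i + 1)" by auto
      then show "expectation (\<lambda>\<omega>. X i \<omega> * X (Suc n) \<omega>) = expectation (\<lambda>\<omega>. X 1 \<omega> * X (n - i + 2) \<omega>)"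
        using expectation_product_shift[of i "n - i + 1"] i by simp
    qed simp
    also have "\<dots> = (\<Sum>h<n - m. expectation (\<lambda>\<omega>. X 1 \<omega> * X (h + 2) \<omega>))"
      by (rule sum.reindex_bij_witness[of _ "\<lambda>h. n - h" "\<lambda>i. n - i"]) auto
    also have "\<dots> \<le> K" using cov[of "n - m"] by linarith
    finally show ?thesis .
  qed
  have "integrable M (\<lambda>\<omega>. (block_sum m n \<omega>)\<^sup>2) \<and>
      expectation (\<lambda>\<omega>. (block_sum m n \<omega>)\<^sup>2) \<le> (?v + 2 * K) * real n"
  proof (induction n)
    case 0
    then show ?case by simp
  next
    case (Suc n)
    show ?case
    proof (cases "m \<le> n")
      case True
      then have ins: "{m<..Suc n} = insert (Suc n) {m<..n}" by auto
      have eq: "(\<lambda>\<omega>. (block_sum m (Suc n) \<omega>)\<^sup>2) =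
          (\<lambda>\<omega>. (block_sum m n \<omega>)\<^sup>2 + (2 * (block_sum m n \<omega> * X (Suc n) \<omega>) + (X (Suc n) \<omega>)\<^sup>2))"
        by (simp add: ins power2_sum fun_eq_iff)
      have int: "integrable M (\<lambda>\<omega>. block_sum m n \<omega> * X (Suc n) \<omega>)"
        unfolding sum_distrib_right by (intro Bochner_Integration.integrable_sum prod) auto
      have "expectation (\<lambda>\<omega>. (block_sum m (Suc n) \<omega>)\<^sup>2) = expectation (\<lambda>\<omega>. (block_sum m n \<omega>)\<^sup>2)
          + (2 * expectation (\<lambda>\<omega>. block_sum m n \<omega> * X (Suc n) \<omega>) + ?v)"
        unfolding eq using Suc int sqk[of "Suc n"] by simp
      also have "\<dots> \<le> (?v + 2 * K) * real n + (2 * K + ?v)"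
        using Suc cross[of n] by auto
      finally have "expectation (\<lambda>\<omega>. (block_sum m (Suc n) \<omega>)\<^sup>2) \<le> (?v + 2 * K) * real (Suc n)"
        by (simp add: algebra_simps)
      moreover have "integrable M (\<lambda>\<omega>. (block_sum m (Suc n) \<omega>)\<^sup>2)"
        unfolding eq using Suc int sqk[of "Suc n"] by simp
      ultimately show ?thesis by blast
    next
      case False
      then have "{m<..Suc n} = {}" by auto
      then show ?thesis using K0 v0 by simp
    qed
  qed
  then show "integrable M (\<lambda>\<omega>. (block_sum m n \<omega>)\<^sup>2)"
    and "expectation (\<lambda>\<omega>. (block_sum m n \<omega>)\<^sup>2) \<le> (?v + 2 * K) * real n" by auto
qed

lemma prob_block_sum_le:
  assumes sq: "integrable M (\<lambda>\<omega>. (X 1 \<omega>)\<^sup>2)"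
    and cov: "\<And>n. \<bar>\<Sum>h<n. expectation (\<lambda>\<omega>. X 1 \<omega> * X (h + 2) \<omega>)\<bar> \<le> K"
    and u: "0 < u"
  shows "prob {\<omega> \<in> space M. u < \<bar>block_sum m n \<omega>\<bar>}
     \<le> (expectation (\<lambda>\<omega>. (X 1 \<omega>)\<^sup>2) + 2 * K) * real n / u\<^sup>2"
proof -
  note mom = second_moment_block_sum[OF sq cov, of m n]
  have "prob {\<omega> \<in> space M. u < \<bar>block_sum m n \<omega>\<bar>} \<le> prob {\<omega> \<in> space M. u\<^sup>2 \<le> (block_sum m n \<omega>)\<^sup>2}"
  proof (rule finite_measure_mono)
    show "{\<omega> \<in> space M. u < \<bar>block_sum m n \<omega>\<bar>} \<subseteq> {\<omega> \<in> space M. u\<^sup>2 \<le> (block_sum m n \<omega>)\<^sup>2}"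
      using u by (auto simp: abs_le_square_iff[symmetric])
  qed measurable
  also have "\<dots> \<le> expectation (\<lambda>\<omega>. (block_sum m n \<omega>)\<^sup>2) / u\<^sup>2"
    using integral_Markov_inequality_measure[OF mom(1), of "{}" "u\<^sup>2"] u by simp
  also have "\<dots> \<le> (expectation (\<lambda>\<omega>. (X 1 \<omega>)\<^sup>2) + 2 * K) * real n / u\<^sup>2"
    using mom(2) by (simp add: divide_right_mono)
  finally show ?thesis .
qed

text \<open>Jensen, then the Markov inequality for the \<open>p\<close>-th moment, which is the same
  for all indices. The order \<open>q powr p\<close> is crude, but the absolute values control every
  partial sum inside the block at once.\<close>

lemma prob_block_abs_sum_le:
  assumes p: "1 \<le> p" and int: "integrable M (\<lambda>\<omega>. \<bar>X 1 \<omega>\<bar> powr p)" and u: "0 < u" and q: "0 < q"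
  shows "prob {\<omega> \<in> space M. u < (\<Sum>i\<in>{m<..m+q}. \<bar>X i \<omega>\<bar>)}
     \<le> real q powr p * expectation (\<lambda>\<omega>. \<bar>X 1 \<omega>\<bar> powr p) / u powr p"
proof -
  let ?E = "expectation (\<lambda>\<omega>. \<bar>X 1 \<omega>\<bar> powr p)"
  have I: "integrable M (\<lambda>\<omega>. \<bar>X k \<omega>\<bar> powr p)" "expectation (\<lambda>\<omega>. \<bar>X k \<omega>\<bar> powr p) = ?E" if "1 \<le> k" for k
    using integrable_marginal[of "\<lambda>x. \<bar>x\<bar> powr p" k] expectation_marginal[of "\<lambda>x. \<bar>x\<bar> powr p" k] that int
    by auto
  define Z where "Z \<omega> = (\<Sum>i\<in>{m<..m+q}. \<bar>X i \<omega>\<bar> powr p)" for \<omega>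
  have Zint: "integrable M Z" unfolding Z_def by (intro Bochner_Integration.integrable_sum I) auto
  have ZE: "expectation Z = real q * ?E"
  proof -
    have "expectation Z = (\<Sum>i\<in>{m<..m+q}. expectation (\<lambda>\<omega>. \<bar>X i \<omega>\<bar> powr p))"
      unfolding Z_def using I(1) by (intro Bochner_Integration.integral_sum) auto
    also have "\<dots> = (\<Sum>i\<in>{m<..m+q}. ?E)" by (intro sum.cong refl I(2)) auto
    finally show ?thesis by simp
  qed
  have jensen: "(\<Sum>i\<in>{m<..m+q}. \<bar>X i \<omega>\<bar>) powr p \<le> real q powr (p - 1) * Z \<omega>" for \<omega>
    using powr_sum_le[of "{m<..m+q}" "\<lambda>i. \<bar>X i \<omega>\<bar>" p] p by (simp add: Z_def)
  \<comment> \<open>By Jensen, a block sum above \<open>u\<close> forces \<open>Z\<close> to reach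
    this level.\<close>
  define c where "c = u powr p / real q powr (p - 1)"
  have c: "0 < c" using u q by (simp add: c_def)
  have "prob {\<omega> \<in> space M. u < (\<Sum>i\<in>{m<..m+q}. \<bar>X i \<omega>\<bar>)} \<le> prob {\<omega> \<in> space M. c \<le> Z \<omega>}"
  proof (rule finite_measure_mono)
    show "{\<omega> \<in> space M. u < (\<Sum>i\<in>{m<..m+q}. \<bar>X i \<omega>\<bar>)} \<subseteq> {\<omega> \<in> space M. c \<le> Z \<omega>}"
    proof safe
      fix \<omega> assume "u < (\<Sum>i\<in>{m<..m+q}. \<bar>X i \<omega>\<bar>)"
      then have "u powr p \<le> (\<Sum>i\<in>{m<..m+q}. \<bar>X i \<omega>\<bar>) powr p"
        using u p by (intro powr_mono2) auto
      also note jensen[of \<omega>]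
      finally show "c \<le> Z \<omega>" using q by (simp add: c_def pos_divide_le_eq mult.commute)
    qed
    have [measurable]: "Z \<in> borel_measurable M" using Zint by (rule borel_measurable_integrable)
    show "{\<omega> \<in> space M. c \<le> Z \<omega>} \<in> events" by measurable
  qed
  also have "\<dots> \<le> expectation Z / c"
  proof (rule integral_Markov_inequality_measure[OF Zint, of "{}"])
    have "0 \<le> Z \<omega>" for \<omega> unfolding Z_def by (rule sum_nonneg) simp
    then show "AE \<omega> in M. 0 \<le> Z \<omega>" by simp
  qed (use c in auto)
  also have "\<dots> = real q powr p * ?E / u powr p"
    using powr_mult_base[of "real q" "p - 1"] q by (simp add: ZE c_def)
  finally show ?thesis .
qed

end

section \<open>Strong mixing\<close>

text \<open>Presents the event family \<open>gen_sigma\<close> as the sets of a measure, so that the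
  measurability rules for sums and comparisons apply to it.\<close>

lemma sets_gen_sigma:
  "sets (sigma (space M) {X i -` A \<inter> space M | i A. i \<in> I \<and> A \<in> sets borel}) = gen_sigma M X I"
  unfolding gen_sigma_def by (rule sets_measure_of) auto

lemma measurable_gen_sigma:
  "i \<in> I \<Longrightarrow> X i \<in> borel_measurable (sigma (space M) {X i -` A \<inter> space M | i A. i \<in> I \<and> A \<in> sets borel})"
  by (rule measurableI) (auto simp: space_measure_of_conv sets_gen_sigma gen_sigma_def)

lemma gen_sigma_mono: "I \<subseteq> J \<Longrightarrow> gen_sigma M X I \<subseteq> gen_sigma M X J"
  unfolding gen_sigma_def by (rule sigma_sets_mono') auto

context stationary_process
begin

abbreviation \<alpha> :: "nat \<Rightarrow> real" where "\<alpha> \<equiv> alpha_coef M X"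

lemma gen_sigma_events:
  assumes "I \<subseteq> {1..}"
  shows "gen_sigma M X I \<subseteq> events"
proof -
  have "{X i -` A \<inter> space M | i A. i \<in> I \<and> A \<in> sets borel} \<subseteq> events"
    using assms measurable_X by (auto intro!: measurable_sets)
  then show ?thesis unfolding gen_sigma_def by (rule sets.sigma_sets_subset)
qed

abbreviation dep :: "'a set \<Rightarrow> 'a set \<Rightarrow> real" where
  "dep A B \<equiv> \<bar>prob (A \<inter> B) - prob A * prob B\<bar>"

text \<open>\<open>alpha_coef\<close> is a nested supremum of reals, which dominates its members
  only if the families are bounded above. This bound by 1 passes through all three levels.\<close>

lemma dep_le_1: "dep A B \<le> 1"
proof -
  have "prob A * prob B \<le> 1" by (intro mult_le_one) auto
  moreover have "prob (A \<inter> B) \<le> 1" "0 \<le> prob (A \<inter> B)" "0 \<le> prob A * prob B" by auto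
  ultimately show ?thesis by linarith
qed

lemma empty_gen_sigma: "{} \<in> gen_sigma M X I"
  unfolding gen_sigma_def by (rule sigma_sets.Empty)

lemma SUP_dep_le_1: "(SUP B\<in>gen_sigma M X I. dep A B) \<le> 1"
  using empty_gen_sigma by (intro cSUP_least dep_le_1) auto

lemma dep_le_SUP: "B \<in> gen_sigma M X I \<Longrightarrow> dep A B \<le> (SUP B\<in>gen_sigma M X I. dep A B)"
  by (rule cSUP_upper) (auto intro!: bdd_aboveI[of _ 1] dep_le_1)

lemma SUP2_dep_le_1: "(SUP A\<in>gen_sigma M X J. SUP B\<in>gen_sigma M X I. dep A B) \<le> 1"
  using empty_gen_sigma by (intro cSUP_least SUP_dep_le_1) auto

lemma SUP_dep_le_SUP2: "A \<in> gen_sigma M X J \<Longrightarrow>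
    (SUP B\<in>gen_sigma M X I. dep A B) \<le> (SUP A\<in>gen_sigma M X J. SUP B\<in>gen_sigma M X I. dep A B)"
  by (rule cSUP_upper) (auto intro!: bdd_aboveI[of _ 1] SUP_dep_le_1)

lemma SUP2_dep_le_alpha: "1 \<le> k \<Longrightarrow>
    (SUP A\<in>gen_sigma M X {1..k}. SUP B\<in>gen_sigma M X {k+n..}. dep A B) \<le> \<alpha> n"
  unfolding alpha_coef_def by (rule cSUP_upper) (auto intro!: bdd_aboveI[of _ 1] SUP2_dep_le_1)

lemma dep_le_alpha:
  assumes "1 \<le> k" "A \<in> gen_sigma M X {1..k}" "B \<in> gen_sigma M X {k+n..}"
  shows "dep A B \<le> \<alpha> n"
  using dep_le_SUP[OF assms(3), of A] SUP_dep_le_SUP2[OF assms(2), of "{k+n..}"]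
    SUP2_dep_le_alpha[OF assms(1), of n] by linarith

lemma alpha_nonneg: "0 \<le> \<alpha> n"
  using dep_le_alpha[of 1 "{}" "{}" n] empty_gen_sigma by simp

text \<open>A larger gap leaves a smaller future sigma-algebra, hence fewer events \<open>B\<close>
  to compare.\<close>

lemma decseq_alpha: "decseq \<alpha>"
proof (intro antimonoI)
  fix m n :: nat
  assume "m \<le> n"
  show "\<alpha> n \<le> \<alpha> m"
    unfolding alpha_coef_def[of M X n]
  proof (intro cSUP_least)
    fix k A B assume "k \<in> {1::nat..}" "A \<in> gen_sigma M X {1..k}" "B \<in> gen_sigma M X {k + n..}"
    moreover from this have "B \<in> gen_sigma M X {k + m..}"
      using \<open>m \<le> n\<close> gen_sigma_mono[of "{k + n..}" "{k + m..}" M X] by auto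
    ultimately show "dep A B \<le> \<alpha> m" by (intro dep_le_alpha) auto
  qed (use empty_gen_sigma in auto)
qed

lemma prob_Int_le:
  assumes "1 \<le> k" "A \<in> gen_sigma M X {1..k}" "B \<in> gen_sigma M X {k+n..}"
  shows "prob (A \<inter> B) \<le> prob A * prob B + \<alpha> n"
  using dep_le_alpha[OF assms] by linarith

text \<open>An Ottaviani-type argument along the grid of multiples of \<open>q\<close>: if the grid sums first
  exceed \<open>3u\<close> at \<open>j * q\<close>, then either the sum after the next block is large, which is almost
  independent of that event, or the full sum is large.\<close>

lemma maximal_inequality:
  assumes q: "1 \<le> q" and u: "0 \<le> u"
    and G: "\<And>m. prob {\<omega> \<in> space M. u < (\<Sum>i\<in>{m<..m+q}. \<bar>X i \<omega>\<bar>)} \<le> g"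
    and H: "\<And>m. prob {\<omega> \<in> space M. u < \<bar>block_sum m n \<omega>\<bar>} \<le> h"
  shows "prob {\<omega> \<in> space M. \<exists>k\<le>n. 4 * u < \<bar>block_sum 0 k \<omega>\<bar>}
      \<le> (real (n div q) + 1) * g + 2 * h + real (n div q) * \<alpha> q"
proof -
  let ?N = "n div q"
  \<comment> \<open>\<open>Gs j\<close>: the block after the grid point \<open>j * q\<close> is
    heavy. \<open>As j\<close>: \<open>j * q\<close> is the first grid point with sum above
    \<open>3 * u\<close>. \<open>Hs j\<close>: the sum from the end of that block to
    \<open>n\<close> is large. The block is the gap that makes \<open>As j\<close> and
    \<open>Hs j\<close> independent up to \<open>\<alpha> q\<close>.\<close>
  define Gs where "Gs j = {\<omega> \<in> space M. u < (\<Sum>i\<in>{j*q<..j*q+q}. \<bar>X i \<omega>\<bar>)}" for j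
  define As where "As j = {\<omega> \<in> space M. 3 * u < \<bar>block_sum 0 (j*q) \<omega>\<bar> \<and>
      (\<forall>i\<in>{..<j}. \<bar>block_sum 0 (i*q) \<omega>\<bar> \<le> 3 * u)}" for j
  define Hs where "Hs j = {\<omega> \<in> space M. u < \<bar>block_sum (j*q+q) n \<omega>\<bar>}" for j
  define E1 where "E1 = {\<omega> \<in> space M. u < \<bar>block_sum 0 n \<omega>\<bar>}"
  have Aev: "As j \<in> gen_sigma M X {1..j*q}" for j
  proof -
    let ?S = "sigma (space M) {X i -` A \<inter> space M | i A. i \<in> {1..j*q} \<and> A \<in> sets borel}"
    have bm: "block_sum 0 (i*q) \<in> borel_measurable ?S" if "i \<le> j" for i
    proof (intro borel_measurable_sum measurable_gen_sigma)
      fix l assume "l \<in> {0<..i*q}"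
      then have "0 < l" "l \<le> i * q" by auto
      moreover have "i * q \<le> j * q" using that by (rule mult_le_mono1)
      ultimately show "l \<in> {1..j*q}" using order_trans[of l "i * q" "j * q"] by simp
    qed
    have "{\<omega> \<in> space ?S. 3 * u < \<bar>block_sum 0 (j*q) \<omega>\<bar> \<and>
      (\<forall>i\<in>{..<j}. \<bar>block_sum 0 (i*q) \<omega>\<bar> \<le> 3 * u)} \<in> sets ?S"
    proof (intro sets.sets_Collect_conj sets.sets_Collect_finite_All)
      have [measurable]: "block_sum 0 (j*q) \<in> borel_measurable ?S" by (rule bm) simp
      show "{\<omega> \<in> space ?S. 3 * u < \<bar>block_sum 0 (j*q) \<omega>\<bar>} \<in> sets ?S" by measurable
    next
      fix i assume "i \<in> {..<j}"
      then have [measurable]: "block_sum 0 (i*q) \<in> borel_measurable ?S" by (intro bm) simp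
      show "{\<omega> \<in> space ?S. \<bar>block_sum 0 (i*q) \<omega>\<bar> \<le> 3 * u} \<in> sets ?S" by measurable
    qed simp
    then show ?thesis unfolding As_def sets_gen_sigma by (simp add: space_measure_of_conv)
  qed
  have Hev: "Hs j \<in> gen_sigma M X {j*q+q..}" for j
  proof -
    let ?S = "sigma (space M) {X i -` A \<inter> space M | i A. i \<in> {j*q+q..} \<and> A \<in> sets borel}"
    have [measurable]: "block_sum (j*q+q) n \<in> borel_measurable ?S"
      by (intro borel_measurable_sum measurable_gen_sigma) auto
    have "{\<omega> \<in> space ?S. u < \<bar>block_sum (j*q+q) n \<omega>\<bar>} \<in> sets ?S" by measurable
    then show ?thesis unfolding Hs_def sets_gen_sigma by (simp add: space_measure_of_conv)
  qed
  have Am: "As j \<in> events" for j using Aev gen_sigma_events[of "{1..j*q}"] by auto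
  have Hm: "Hs j \<in> events" for j
    unfolding Hs_def by measurable
  have Gm: "Gs j \<in> events" for j
  proof -
    have [measurable]: "(\<lambda>\<omega>. \<Sum>i\<in>{j*q<..j*q+q}. \<bar>X i \<omega>\<bar>) \<in> borel_measurable M"
      using measurable_X by (intro borel_measurable_sum borel_measurable_abs) auto
    show ?thesis unfolding Gs_def by measurable
  qed
  have E1m: "E1 \<in> events" unfolding E1_def by measurable
  have h0: "0 \<le> h" using H[of 0] measure_nonneg order_trans by blast
  \<comment> \<open>If no block is heavy, an excess over \<open>4 * u\<close> at \<open>k\<close>
    leaves more than \<open>3 * u\<close> at the grid point before it. Beyond the first such grid
    point \<open>i * q\<close>, the next block contributes at most \<open>u\<close> and, if
    \<open>Hs i\<close> fails, the tail at most \<open>u\<close>, so the full sum still exceeds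
    \<open>u\<close>.\<close>
  have cover: "{\<omega> \<in> space M. \<exists>k\<le>n. 4 * u < \<bar>block_sum 0 k \<omega>\<bar>}
      \<subseteq> (\<Union>j\<in>{..?N}. Gs j) \<union> E1 \<union> (\<Union>j\<in>{1..?N}. As j \<inter> Hs j)"
  proof
    fix \<omega> assume "\<omega> \<in> {\<omega> \<in> space M. \<exists>k\<le>n. 4 * u < \<bar>block_sum 0 k \<omega>\<bar>}"
    then obtain k where \<omega>: "\<omega> \<in> space M" and k: "k \<le> n" "4 * u < \<bar>block_sum 0 k \<omega>\<bar>" by auto
    show "\<omega> \<in> (\<Union>j\<in>{..?N}. Gs j) \<union> E1 \<union> (\<Union>j\<in>{1..?N}. As j \<inter> Hs j)"
    proof (rule ccontr)
      assume neg: "\<omega> \<notin> (\<Union>j\<in>{..?N}. Gs j) \<union> E1 \<union> (\<Union>j\<in>{1..?N}. As j \<inter> Hs j)"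
      have blk: "\<bar>block_sum (j*q) l \<omega>\<bar> \<le> u" if "j \<le> ?N" "l \<le> j*q+q" for j l
      proof -
        have "\<bar>block_sum (j*q) l \<omega>\<bar> \<le> (\<Sum>i\<in>{j*q<..l}. \<bar>X i \<omega>\<bar>)" by (rule sum_abs)
        also have "\<dots> \<le> (\<Sum>i\<in>{j*q<..j*q+q}. \<bar>X i \<omega>\<bar>)" using that by (intro sum_mono2) auto
        also have "\<dots> \<le> u" using neg \<omega> that by (auto simp: Gs_def not_less)
        finally show ?thesis .
      qed
      have split: "block_sum a c \<omega> = block_sum a b \<omega> + block_sum b c \<omega>" if "a \<le> b" "b \<le> c" for a b c
        using that by (subst sum.union_disjoint[symmetric]) (auto intro!: sum.cong)
      define j where "j = k div q"
      have "k mod q < q" using q by simp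
      then have j: "j \<le> ?N" "j * q \<le> k" "k \<le> j * q + q"
        using div_le_mono[OF k(1), of q] div_mult_mod_eq[of k q] unfolding j_def by linarith+
      have "3 * u < \<bar>block_sum 0 (j*q) \<omega>\<bar>"
        using split[of 0 "j*q" k] blk[OF j(1,3)] k(2) j(2) by linarith
      then obtain i where i: "3 * u < \<bar>block_sum 0 (i*q) \<omega>\<bar>" "i \<le> j"
          "\<forall>l<i. \<not> 3 * u < \<bar>block_sum 0 (l*q) \<omega>\<bar>"
        using ex_least_nat_le[of "\<lambda>j. 3 * u < \<bar>block_sum 0 (j*q) \<omega>\<bar>" j] by auto
      \<comment> \<open>The empty sum cannot exceed \<open>3 * u\<close>; the mixing bound requires
        a nonempty past.\<close>
      have "i \<noteq> 0" using i(1) u by (intro notI) simp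
      then have iN: "i \<in> {1..?N}" using i(2) j(1) by auto
      have "\<omega> \<in> As i" using i \<omega> by (auto simp: As_def not_less)
      then have "\<omega> \<notin> Hs i" using neg iN by blast
      then have tail: "\<bar>block_sum (i*q+q) n \<omega>\<bar> \<le> u" using \<omega> by (auto simp: Hs_def not_less)
      have full: "\<bar>block_sum 0 n \<omega>\<bar> \<le> u" using neg \<omega> by (auto simp: E1_def not_less)
      have "i * q \<le> ?N * q" using iN by auto
      then have iq: "i * q \<le> n" using div_times_less_eq_dividend[of n q] by linarith
      have "\<bar>block_sum (i*q) n \<omega>\<bar> \<le> 2 * u"
      proof (cases "i * q + q \<le> n")
        case True
        then show ?thesis using split[of "i*q" "i*q+q" n] blk[of i "i*q+q"] iN tail by auto
      next
        case False
        then show ?thesis using blk[of i n] iN u by auto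
      qed
      then show False using split[of 0 "i*q" n] iq i(1) full by linarith
    qed
  qed
  have pG: "prob (\<Union>j\<in>{..?N}. Gs j) \<le> (real ?N + 1) * g"
  proof -
    have "prob (\<Union>j\<in>{..?N}. Gs j) \<le> (\<Sum>j\<in>{..?N}. prob (Gs j))"
      using Gm by (intro finite_measure_subadditive_finite) auto
    also have "\<dots> \<le> (\<Sum>j\<in>{..?N}. g)" unfolding Gs_def by (intro sum_mono G)
    finally show ?thesis by (simp add: algebra_simps)
  qed
  have pA: "prob (\<Union>j\<in>{1..?N}. As j \<inter> Hs j) \<le> h + real ?N * \<alpha> q"
  proof -
    \<comment> \<open>First passages at different grid points exclude each other, so the
      probabilities of the \<open>As j\<close> add up to at most 1 and the factor \<open>h\<close>
      is paid only once.\<close>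
    have "As i \<inter> As j = {}" if "i < j" for i j
      using that by (force simp: As_def not_less[symmetric])
    then have disj: "disjoint_family_on As {1..?N}"
      unfolding disjoint_family_on_def by (metis Int_commute linorder_neqE_nat)
    have "prob (\<Union>j\<in>{1..?N}. As j \<inter> Hs j) \<le> (\<Sum>j\<in>{1..?N}. prob (As j \<inter> Hs j))"
      using Am Hm by (intro finite_measure_subadditive_finite) auto
    also have "\<dots> \<le> (\<Sum>j\<in>{1..?N}. prob (As j) * h + \<alpha> q)"
    proof (rule sum_mono)
      fix j assume "j \<in> {1..?N}"
      then have "1 \<le> j * q" using q by auto
      then have "prob (As j \<inter> Hs j) \<le> prob (As j) * prob (Hs j) + \<alpha> q"
        using Aev Hev by (rule prob_Int_le)
      also have "\<dots> \<le> prob (As j) * h + \<alpha> q"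
        using H[of "j*q+q"] unfolding Hs_def by (intro add_right_mono mult_left_mono) auto
      finally show "prob (As j \<inter> Hs j) \<le> prob (As j) * h + \<alpha> q" .
    qed
    also have "\<dots> = prob (\<Union>j\<in>{1..?N}. As j) * h + real ?N * \<alpha> q"
      using Am disj by (subst finite_measure_finite_Union) (auto simp: sum.distrib sum_distrib_right)
    also have "\<dots> \<le> h + real ?N * \<alpha> q"
      using h0 by (intro add_right_mono mult_left_le_one_le) auto
    finally show ?thesis .
  qed
  have "prob {\<omega> \<in> space M. \<exists>k\<le>n. 4 * u < \<bar>block_sum 0 k \<omega>\<bar>}
      \<le> prob ((\<Union>j\<in>{..?N}. Gs j) \<union> E1 \<union> (\<Union>j\<in>{1..?N}. As j \<inter> Hs j))"
    using cover Gm E1m Am Hm by (intro finite_measure_mono) auto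
  also have "\<dots> \<le> prob (\<Union>j\<in>{..?N}. Gs j) + prob E1 + prob (\<Union>j\<in>{1..?N}. As j \<inter> Hs j)"
  proof -
    have "prob ((\<Union>j\<in>{..?N}. Gs j) \<union> E1 \<union> (\<Union>j\<in>{1..?N}. As j \<inter> Hs j))
      \<le> prob ((\<Union>j\<in>{..?N}. Gs j) \<union> E1) + prob (\<Union>j\<in>{1..?N}. As j \<inter> Hs j)"
      using Gm E1m Am Hm by (intro measure_Un_le) auto
    moreover have "prob ((\<Union>j\<in>{..?N}. Gs j) \<union> E1) \<le> prob (\<Union>j\<in>{..?N}. Gs j) + prob E1"
      using Gm E1m by (intro measure_Un_le) auto
    ultimately show ?thesis by linarith
  qed
  also have "\<dots> \<le> (real ?N + 1) * g + h + (h + real ?N * \<alpha> q)"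
    using pG pA H[of 0] unfolding E1_def by linarith
  finally show ?thesis by simp
qed

text \<open>A run in a set \<open>B\<close> continues over a gap of length \<open>g\<close> with conditional probability close to
  \<open>P(X 1 \<in> B)\<close>, so its limiting probability \<open>f\<close> satisfies \<open>f \<le> f * P(X 1 \<in> B)\<close>.\<close>

lemma prob_run_tendsto_0:
  assumes B: "B \<in> sets borel" and lt: "prob {\<omega> \<in> space M. X 1 \<omega> \<in> B} < 1" and \<alpha>0: "\<alpha> \<longlonglongrightarrow> 0"
  shows "(\<lambda>m. prob {\<omega> \<in> space M. \<forall>i\<in>{1..m}. X i \<omega> \<in> B}) \<longlonglongrightarrow> 0"
proof -
  let ?p = "prob {\<omega> \<in> space M. X 1 \<omega> \<in> B}"
  define F where "F m = {\<omega> \<in> space M. \<forall>i\<in>{1..m}. X i \<omega> \<in> B}" for m :: nat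
  have Fgen: "F m \<in> gen_sigma M X {1..m}" for m
  proof -
    let ?S = "sigma (space M) {X i -` A \<inter> space M | i A. i \<in> {1..m} \<and> A \<in> sets borel}"
    have "{\<omega> \<in> space ?S. \<forall>i\<in>{1..m}. X i \<omega> \<in> B} \<in> sets ?S"
    proof (rule sets.sets_Collect_finite_All)
      fix i assume "i \<in> {1..m}"
      then have [measurable]: "X i \<in> borel_measurable ?S" by (rule measurable_gen_sigma)
      show "{\<omega> \<in> space ?S. X i \<omega> \<in> B} \<in> sets ?S" using B by measurable
    qed auto
    then show ?thesis unfolding F_def sets_gen_sigma by (simp add: space_measure_of_conv)
  qed
  have Fm: "F m \<in> events" for m using Fgen gen_sigma_events[of "{1..m}"] by auto
  have dec: "decseq (\<lambda>m. prob (F m))"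
    using Fm by (intro decseq_SucI finite_measure_mono) (auto simp: F_def)
  then obtain f where f: "(\<lambda>m. prob (F m)) \<longlonglongrightarrow> f"
    using decseq_convergent[of "\<lambda>m. prob (F m)" 0] by auto
  have f0: "0 \<le> f" by (rule LIMSEQ_le_const[OF f]) auto
  have step: "prob (F (m + g)) \<le> prob (F m) * ?p + \<alpha> g" if "1 \<le> m" for m g
  proof -
    let ?C = "{\<omega> \<in> space M. X (m + g) \<omega> \<in> B}"
    have C: "?C \<in> gen_sigma M X {m+g..}"
      unfolding gen_sigma_def using B by (intro sigma_sets.Basic) (auto intro!: exI[of _ "m + g"] exI[of _ B])
    have "prob (F (m + g)) \<le> prob (F m \<inter> ?C)"
      using Fm C gen_sigma_events[of "{m+g..}"] that by (intro finite_measure_mono sets.Int) (auto simp: F_def)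
    also have "\<dots> \<le> prob (F m) * prob ?C + \<alpha> g" using that Fgen C by (rule prob_Int_le)
    also have "prob ?C = ?p" using that by (intro prob_marginal B) auto
    finally show ?thesis .
  qed
  \<comment> \<open>Here \<open>m\<close> tends to infinity with the gap \<open>g\<close> fixed;
    afterwards \<open>g\<close> tends to infinity and removes \<open>\<alpha> g\<close>.\<close>
  have "f \<le> f * ?p + \<alpha> g" for g
  proof (rule LIMSEQ_le)
    show "(\<lambda>m. prob (F (m + g))) \<longlonglongrightarrow> f" using f by (rule LIMSEQ_ignore_initial_segment)
    show "(\<lambda>m. prob (F m) * ?p + \<alpha> g) \<longlonglongrightarrow> f * ?p + \<alpha> g" by (intro tendsto_intros f)
    show "\<exists>N. \<forall>m\<ge>N. prob (F (m + g)) \<le> prob (F m) * ?p + \<alpha> g" using step by blast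
  qed
  moreover have "(\<lambda>g. f * ?p + \<alpha> g) \<longlonglongrightarrow> f * ?p + 0" by (intro tendsto_intros \<alpha>0)
  ultimately have "f \<le> f * ?p" using LIMSEQ_le_const[of "\<lambda>g. f * ?p + \<alpha> g" "f * ?p + 0" f] by auto
  then have "f * (1 - ?p) \<le> 0" by (simp add: algebra_simps)
  then have "f = 0" using lt f0 by (simp add: mult_le_0_iff)
  then show ?thesis using f by (simp add: F_def)
qed

end

section \<open>Tightness of the maximal partial sum\<close>

text \<open>As \<open>a\<close> decreases, \<open>n\<close> copies of \<open>a n powr s\<close> are
  below the first \<open>n\<close> terms of the series, hence below its sum; the power
  \<open>1 / s\<close> turns this into a polynomial rate.\<close>

lemma decseq_summable_powr_bound:
  fixes a :: "nat \<Rightarrow> real"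
  assumes nn: "\<And>n. 0 \<le> a n" and anti: "decseq a"
    and s: "0 < s" and sum: "summable (\<lambda>n. a (Suc n) powr s)"
  shows "\<exists>C\<ge>0. \<forall>n\<ge>1. a n \<le> C * real n powr (- 1 / s)"
proof (intro exI conjI allI impI)
  let ?T = "\<Sum>n. a (Suc n) powr s"
  have T: "0 \<le> ?T" by (intro suminf_nonneg sum) simp
  show "0 \<le> ?T powr (1 / s)" by simp
  fix n :: nat assume n: "1 \<le> n"
  have "real n * a n powr s = (\<Sum>k<n. a n powr s)" by simp
  also have "\<dots> \<le> (\<Sum>k<n. a (Suc k) powr s)"
    using s by (intro sum_mono powr_mono2 nn decseqD[OF anti]) auto
  also have "\<dots> \<le> ?T" by (intro sum_le_suminf sum) auto
  finally have "a n powr s \<le> ?T / real n" using n by (simp add: field_simps)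
  then have "(a n powr s) powr (1 / s) \<le> (?T / real n) powr (1 / s)"
    using s by (intro powr_mono2) auto
  then have "a n \<le> (?T / real n) powr (1 / s)" using s nn[of n] by (simp add: powr_powr)
  also have "\<dots> = ?T powr (1 / s) * real n powr (- 1 / s)"
    using T n by (simp add: powr_divide powr_minus_divide)
  finally show "a n \<le> ?T powr (1 / s) * real n powr (- 1 / s)" .
qed

context stationary_process
begin

text \<open>\<open>maximal_inequality\<close> with \<open>u = c n * sqrt (real n) / 4\<close> and
  \<open>q\<close> the ceiling of \<open>n powr a\<close>: Chebyshev supplies \<open>h\<close>, the
  crude block bound supplies \<open>g\<close>, and the rate of \<alpha> controls the mixing
  term.\<close>

lemma prob_max_partial_sum_tendsto_0:
  assumes sq: "integrable M (\<lambda>\<omega>. (X 1 \<omega>)\<^sup>2)"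
    and cov: "\<And>n. \<bar>\<Sum>h<n. expectation (\<lambda>\<omega>. X 1 \<omega> * X (h + 2) \<omega>)\<bar> \<le> K"
    and p: "2 < p" and int: "integrable M (\<lambda>\<omega>. \<bar>X 1 \<omega>\<bar> powr p)"
    and s: "0 < s" "s < 1 - 2 / p"
    and A: "0 \<le> A" "\<And>n. 1 \<le> n \<Longrightarrow> \<alpha> n \<le> A * real n powr (- 1 / s)"
    and c: "filterlim c at_top sequentially"
  shows "(\<lambda>n. prob {\<omega> \<in> space M. \<exists>k\<le>n. c n * sqrt (real n) < \<bar>block_sum 0 k \<omega>\<bar>}) \<longlonglongrightarrow> 0"
proof -
  let ?V = "expectation (\<lambda>\<omega>. (X 1 \<omega>)\<^sup>2) + 2 * K"
  let ?E = "expectation (\<lambda>\<omega>. \<bar>X 1 \<omega>\<bar> powr p)"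
  have K: "0 \<le> K" using cov[of 0] by simp
  have E: "0 \<le> ?E" by simp
  \<comment> \<open>The mixing term needs \<open>a\<close> above the left end and the block term
    needs \<open>a\<close> below the right end; \<open>s < 1 - 2 / p\<close> is exactly the
    condition that leaves room between them.\<close>
  have "s * p < p - 2" using s(2) p by (simp add: field_simps)
  then have "s * (2 * (p - 1)) < (p - 2) * (1 + s)" by (simp add: algebra_simps)
  then have "s / (1 + s) < (p - 2) / (2 * (p - 1))" using s p by (simp add: field_simps)
  then obtain a where a: "s / (1 + s) < a" "a < (p - 2) / (2 * (p - 1))" using dense by blast
  have "0 < s / (1 + s)" using s by simp
  then have a0: "0 < a" using a(1) by linarith
  have "(p - 2) / (2 * (p - 1)) < 1" using p by (simp add: field_simps)
  then have a1: "a < 1" using a(2) by linarith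
  \<comment> \<open>With \<open>q\<close> of order \<open>n powr a\<close> and \<open>u\<close> at
    least \<open>sqrt n\<close> (true once \<open>c n \<ge> 4\<close>), the block term
    \<open>(n / q) * (q / u) powr p\<close> is of order at most \<open>n powr (- b)\<close>, and the
    mixing term \<open>(n / q) * q powr (- 1 / s)\<close> of order at most
    \<open>n powr (- d)\<close>.\<close>
  define b where "b = p / 2 - 1 - a * (p - 1)"
  define d where "d = a * (1 + 1 / s) - 1"
  have b: "0 < b" using a(2) p by (simp add: b_def field_simps)
  have d: "0 < d" using a(1) s by (simp add: d_def field_simps)
  \<comment> \<open>In \<open>2 powr p\<close>, one factor 2 comes from
    \<open>n div q + 1 \<le> 2 * n / q\<close> and the others from
    \<open>q \<le> 2 * n powr a\<close>. In 32, the 16 is the square of the 4 in \<open>u\<close>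
    and the 2 belongs to \<open>2 * h\<close>.\<close>
  define B where "B n = 2 powr p * ?E * real n powr (- b) + 32 * ?V * inverse (c n * c n)
      + A * real n powr (- d)" for n
  have neg_powr: "(\<lambda>n. real n powr (- e)) \<longlonglongrightarrow> 0" if "0 < e" for e
    by (rule tendsto_neg_powr) (use that filterlim_real_sequentially in auto)
  have "(\<lambda>n. inverse (c n * c n)) \<longlonglongrightarrow> 0"
    by (intro tendsto_inverse_0_at_top filterlim_at_top_mult_at_top c)
  then have "B \<longlonglongrightarrow> 2 powr p * ?E * 0 + 32 * ?V * 0 + A * 0"
    unfolding B_def by (intro tendsto_add tendsto_mult tendsto_const neg_powr b d)
  then have B0: "B \<longlonglongrightarrow> 0" by simp
  have "\<forall>\<^sub>F n in sequentially. 4 \<le> c n" using c by (simp add: filterlim_at_top)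
  moreover have "\<forall>\<^sub>F n::nat in sequentially. 1 \<le> n" by (rule eventually_ge_at_top)
  ultimately have bound: "\<forall>\<^sub>F n in sequentially.
      prob {\<omega> \<in> space M. \<exists>k\<le>n. c n * sqrt (real n) < \<bar>block_sum 0 k \<omega>\<bar>} \<le> B n"
  proof eventually_elim
    case (elim n)
    let ?x = "real n powr a"
    define q where "q = nat \<lceil>?x\<rceil>"
    define u where "u = c n * sqrt (real n) / 4"
    have n: "1 \<le> real n" using elim by simp
    have x1: "1 \<le> ?x" using n a0 by (simp add: ge_one_powr_ge_zero)
    have "?x \<le> real n powr 1" using n a1 by (intro powr_mono) auto
    then have xn: "?x \<le> real n" using n by simp
    have qr: "real q = of_int \<lceil>?x\<rceil>" unfolding q_def using x1 by simp
    have qx: "?x \<le> real q" "real q \<le> 2 * ?x" unfolding qr using x1 by linarith+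
    have q: "1 \<le> real q" "1 \<le> q" using qx x1 by linarith+
    have "\<lceil>?x\<rceil> \<le> int n" using xn by (simp add: ceiling_le_iff)
    then have qn: "real q \<le> real n" unfolding q_def by simp
    have su: "sqrt (real n) \<le> u"
      using mult_right_mono[of 4 "c n" "sqrt (real n)"] elim(1) by (simp add: u_def)
    have u: "0 < u" using su n by (smt (verit) real_sqrt_gt_0_iff)
    have Nn: "real (n div q) \<le> real n / real q" by (rule of_nat_div_le_of_nat)
    have T1: "(real (n div q) + 1) * (real q powr p * ?E / u powr p) \<le> 2 powr p * ?E * real n powr (- b)"
    proof -
      have "1 \<le> real n / real q" using qn q by simp
      then have N2: "real (n div q) + 1 \<le> 2 * (real n / real q)" using Nn by linarith
      have "(real (n div q) + 1) * (real q powr p * ?E / u powr p)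
          \<le> 2 * (real n / real q) * (real q powr p * ?E / u powr p)"
        by (intro mult_right_mono N2) auto
      also have "\<dots> = 2 * real n * ?E * real q powr (p - 1) / u powr p"
        using powr_mult_base[of "real q" "p - 1", symmetric] q by simp
      also have "\<dots> \<le> 2 * real n * ?E * (2 * ?x) powr (p - 1) / sqrt (real n) powr p"
        using p n su qx q by (intro frac_le mult_left_mono powr_mono2 mult_nonneg_nonneg E) auto
      also have "\<dots> = 2 powr p * ?E * (real n powr 1 * real n powr (a * (p - 1)) / real n powr (p / 2))"
        using powr_mult_base[of 2 "p - 1"] n
        by (simp add: powr_mult powr_powr powr_half_sqrt[symmetric] field_simps)
      also have "real n powr 1 * real n powr (a * (p - 1)) / real n powr (p / 2) = real n powr (- b)"
        using n by (simp only: powr_add[symmetric] powr_diff[symmetric]) (simp add: b_def algebra_simps)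
      finally show ?thesis .
    qed
    have T2: "2 * (?V * real n / u\<^sup>2) = 32 * ?V * inverse (c n * c n)"
    proof -
      have u2: "u\<^sup>2 = c n * c n * real n / 16"
        using n by (simp add: u_def power_divide power_mult_distrib power2_eq_square)
      have "2 * (v * real n / (c n * c n * real n / 16)) = 32 * v * inverse (c n * c n)" for v
        using n elim(1) by (simp add: field_simps)
      then show ?thesis unfolding u2 .
    qed
    have T3: "real (n div q) * \<alpha> q \<le> A * real n powr (- d)"
    proof -
      have "0 < 1 / s" using s by simp
      then have e: "- (1 + 1 / s) \<le> 0" by linarith
      have "real (n div q) * \<alpha> q \<le> (real n / real q) * (A * real q powr (- 1 / s))"
        using Nn A q alpha_nonneg by (intro mult_mono) auto
      also have "\<dots> = A * real n * (real q powr (- 1) * real q powr (- 1 / s))"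
        using q by (simp add: powr_minus_divide)
      also have "\<dots> = A * real n * real q powr (- (1 + 1 / s))"
        by (simp only: powr_add[symmetric]) simp
      also have "\<dots> \<le> A * real n * ?x powr (- (1 + 1 / s))"
        using A qx x1 e elim(2) by (intro mult_left_mono powr_mono2') auto
      also have "\<dots> = A * (real n powr 1 * real n powr (a * (- (1 + 1 / s))))"
        using n by (simp add: powr_powr)
      also have "\<dots> = A * real n powr (- d)"
        by (simp only: powr_add[symmetric]) (simp add: d_def algebra_simps)
      finally show ?thesis .
    qed
    have "prob {\<omega> \<in> space M. \<exists>k\<le>n. c n * sqrt (real n) < \<bar>block_sum 0 k \<omega>\<bar>}
        = prob {\<omega> \<in> space M. \<exists>k\<le>n. 4 * u < \<bar>block_sum 0 k \<omega>\<bar>}"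
      by (simp add: u_def)
    also have "\<dots> \<le> (real (n div q) + 1) * (real q powr p * ?E / u powr p) + 2 * (?V * real n / u\<^sup>2)
        + real (n div q) * \<alpha> q"
      using p q u by (intro maximal_inequality prob_block_abs_sum_le int prob_block_sum_le sq cov) auto
    also have "\<dots> \<le> B n" unfolding B_def using T1 T2 T3 by linarith
    finally show ?case .
  qed
  show ?thesis
    by (rule real_tendsto_sandwich[OF _ bound tendsto_const B0]) simp
qed

end

text \<open>A centered variable that almost surely has one weak sign vanishes almost surely, which
  contradicts unit variance.\<close>

lemma (in prob_space) prob_lt_1_of_nondegenerate:
  fixes X :: "'a \<Rightarrow> real"
  assumes int: "integrable M X" and mean: "expectation X = 0" and var: "variance X = 1"
  shows "prob {\<omega> \<in> space M. 0 \<le> X \<omega>} < 1" and "prob {\<omega> \<in> space M. X \<omega> \<le> 0} < 1"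
proof -
  have [measurable]: "X \<in> borel_measurable M" using int by (rule borel_measurable_integrable)
  have not0: "\<not> (AE \<omega> in M. X \<omega> = 0)"
  proof
    assume "AE \<omega> in M. X \<omega> = 0"
    then have "AE \<omega> in M. (X \<omega> - expectation X)\<^sup>2 = 0" by (simp add: mean)
    then have "variance X = expectation (\<lambda>_. 0)" by (intro integral_cong_AE) auto
    then show False using var by simp
  qed
  have ae: "AE \<omega> in M. \<omega> \<in> S" if "S \<in> events" "\<not> prob S < 1" for S
    using that prob_le_1[of S] by (intro prob_eq_1[THEN iffD1]) auto
  show "prob {\<omega> \<in> space M. 0 \<le> X \<omega>} < 1"
  proof (rule ccontr)
    assume "\<not> ?thesis"
    then have "AE \<omega> in M. \<omega> \<in> {\<omega> \<in> space M. 0 \<le> X \<omega>}" by (intro ae) auto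
    then have "AE \<omega> in M. 0 \<le> X \<omega>" by auto
    then show False using not0 integral_nonneg_eq_0_iff_AE[OF int] mean by simp
  qed
  show "prob {\<omega> \<in> space M. X \<omega> \<le> 0} < 1"
  proof (rule ccontr)
    assume "\<not> ?thesis"
    then have "AE \<omega> in M. \<omega> \<in> {\<omega> \<in> space M. X \<omega> \<le> 0}" by (intro ae) auto
    then have "AE \<omega> in M. 0 \<le> - X \<omega>" by auto
    then show False using not0 integral_nonneg_eq_0_iff_AE[of M "\<lambda>\<omega>. - X \<omega>"] int mean by simp
  qed
qed

section \<open>Weights of bounded variation\<close>

text \<open>Two points outside \<open>D\<close> with the same points of \<open>D\<close> on their
  left have no point of \<open>D\<close> between them, so their \<sigma>-values differ by at most
  \<open>\<bar>L\<bar>\<close>. There are finitely many such classes, and the points of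
  \<open>D\<close> are treated one by one.\<close>

lemma assumption_V_bounded:
  assumes "assumption_V \<sigma>"
  obtains B where "0 \<le> B" "\<And>x. x \<in> {0..1} \<Longrightarrow> \<bar>\<sigma> x\<bar> \<le> B"
proof -
  obtain D L where D: "finite D"
    and lip: "\<And>x y. x \<in> {0..1} \<Longrightarrow> y \<in> {0..1} \<Longrightarrow> D \<inter> {min x y..max x y} = {} \<Longrightarrow>
          \<bar>\<sigma> x - \<sigma> y\<bar> \<le> L * \<bar>x - y\<bar>"
    using assms unfolding assumption_V_def by blast
  \<comment> \<open>The set \<open>T\<close> of points of \<open>D\<close> left of \<open>x\<close>
    labels the component that contains \<open>x\<close>.\<close>
  have "\<exists>b. \<forall>x\<in>{0..1} - D. {d \<in> D. d < x} = T \<longrightarrow> \<bar>\<sigma> x\<bar> \<le> b" for T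
  proof (cases "\<exists>x\<in>{0..1} - D. {d \<in> D. d < x} = T")
    case True
    then obtain x where x: "x \<in> {0..1}" "x \<notin> D" "{d \<in> D. d < x} = T" by auto
    have "\<bar>\<sigma> y\<bar> \<le> \<bar>\<sigma> x\<bar> + \<bar>L\<bar>" if y: "y \<in> {0..1}" "y \<notin> D" "{d \<in> D. d < y} = T" for y
    proof -
      have iff: "d < x \<longleftrightarrow> d < y" if "d \<in> D" for d using x(3) y(3) that by blast
      have "D \<inter> {min x y..max x y} = {}"
      proof (rule ccontr)
        assume "\<not> ?thesis"
        then obtain d where d: "d \<in> D" "min x y \<le> d" "d \<le> max x y" by auto
        moreover have "d \<noteq> x" "d \<noteq> y" using d(1) x(2) y(2) by blast+
        ultimately show False using iff[OF d(1)] by (auto simp: min_def max_def split: if_splits)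
      qed
      then have "\<bar>\<sigma> x - \<sigma> y\<bar> \<le> L * \<bar>x - y\<bar>" by (rule lip[OF x(1) y(1)])
      also have "\<dots> \<le> \<bar>L\<bar> * 1" using x(1) y(1) by (intro mult_mono) auto
      finally show ?thesis by linarith
    qed
    then show ?thesis by blast
  qed blast
  then obtain b where b: "\<And>T x. x \<in> {0..1} - D \<Longrightarrow> {d \<in> D. d < x} = T \<Longrightarrow> \<bar>\<sigma> x\<bar> \<le> b T" by metis
  let ?B = "(\<Sum>T\<in>Pow D. \<bar>b T\<bar>) + (\<Sum>d\<in>D. \<bar>\<sigma> d\<bar>)"
  have nn: "0 \<le> (\<Sum>T\<in>Pow D. \<bar>b T\<bar>)" "0 \<le> (\<Sum>d\<in>D. \<bar>\<sigma> d\<bar>)" by (auto intro: sum_nonneg)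
  show ?thesis
  proof
    show "0 \<le> ?B" using nn by linarith
    fix x :: real assume x: "x \<in> {0..1}"
    show "\<bar>\<sigma> x\<bar> \<le> ?B"
    proof (cases "x \<in> D")
      case True
      then have "\<bar>\<sigma> x\<bar> \<le> (\<Sum>d\<in>D. \<bar>\<sigma> d\<bar>)" using D by (intro member_le_sum) auto
      then show ?thesis using nn by linarith
    next
      case False
      have "\<bar>\<sigma> x\<bar> \<le> b {d \<in> D. d < x}" using b[of x] x False by blast
      moreover have "\<bar>b {d \<in> D. d < x}\<bar> \<le> (\<Sum>T\<in>Pow D. \<bar>b T\<bar>)"
        by (rule member_le_sum[where f = "\<lambda>T. \<bar>b T\<bar>"]) (use D in auto)
      ultimately show ?thesis using nn by linarith
    qed
  qed
qed

text \<open>Only cells of the grid that meet a discontinuity point can have an increment above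
  \<open>L / n\<close>, and each such point lies in at most two closed cells.\<close>

lemma assumption_V_variation:
  assumes "assumption_V \<sigma>"
  obtains V where "0 \<le> V"
    "\<And>n. (\<Sum>i<n. \<bar>\<sigma> (real (Suc i) / real n) - \<sigma> (real i / real n)\<bar>) \<le> V"
proof -
  obtain D L where D: "finite D"
    and lip: "\<And>x y. x \<in> {0..1} \<Longrightarrow> y \<in> {0..1} \<Longrightarrow> D \<inter> {min x y..max x y} = {} \<Longrightarrow>
          \<bar>\<sigma> x - \<sigma> y\<bar> \<le> L * \<bar>x - y\<bar>"
    using assms unfolding assumption_V_def by blast
  obtain B where B: "0 \<le> B" "\<And>x. x \<in> {0..1} \<Longrightarrow> \<bar>\<sigma> x\<bar> \<le> B"
    using assumption_V_bounded[OF assms] by blast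
  let ?V = "\<bar>L\<bar> + 2 * B * (2 * real (card D))"
  show ?thesis
  proof
    show "0 \<le> ?V" using B by simp
    fix n :: nat
    define H where "H i d = (if real i / real n \<le> d \<and> d \<le> real (Suc i) / real n then 1 else 0 :: real)" for i d
    have cell: "\<bar>\<sigma> (real (Suc i) / real n) - \<sigma> (real i / real n)\<bar> \<le> \<bar>L\<bar> / real n + 2 * B * (\<Sum>d\<in>D. H i d)"
      if "i < n" for i
    proof -
      have in01: "real (Suc i) / real n \<in> {0..1}" "real i / real n \<in> {0..1}"
        and le: "real i / real n \<le> real (Suc i) / real n"
        and diff: "real (Suc i) / real n - real i / real n = 1 / real n"
        using that by (auto simp: field_simps)
      show ?thesis
      proof (cases "D \<inter> {real i / real n..real (Suc i) / real n} = {}")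
        case True
        then have "\<bar>\<sigma> (real (Suc i) / real n) - \<sigma> (real i / real n)\<bar>
            \<le> L * \<bar>real (Suc i) / real n - real i / real n\<bar>"
          using le by (intro lip in01) (simp add: min_absorb2 max_absorb1)
        also have "\<dots> \<le> \<bar>L\<bar> / real n" unfolding diff by (simp add: divide_right_mono)
        moreover have "0 \<le> 2 * B * (\<Sum>d\<in>D. H i d)"
          using B by (intro mult_nonneg_nonneg sum_nonneg) (auto simp: H_def)
        ultimately show ?thesis by linarith
      next
        case False
        then obtain d where "d \<in> D" "d \<in> {real i / real n..real (Suc i) / real n}" by blast
        then have d: "d \<in> D" "H i d = 1" by (auto simp: H_def)
        have "H i d \<le> (\<Sum>d\<in>D. H i d)" using d D by (intro member_le_sum) (auto simp: H_def)
        then have "2 * B * 1 \<le> 2 * B * (\<Sum>d\<in>D. H i d)" using d B by (intro mult_left_mono) auto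
        moreover have "\<bar>\<sigma> (real (Suc i) / real n) - \<sigma> (real i / real n)\<bar> \<le> 2 * B"
          using B(2)[OF in01(1)] B(2)[OF in01(2)] by linarith
        moreover have "0 \<le> \<bar>L\<bar> / real n" by simp
        ultimately show ?thesis by linarith
      qed
    qed
    have cells: "(\<Sum>i<n. H i d) \<le> 2" for d
    proof -
      \<comment> \<open>That \<open>d\<close> lies in the closed cell \<open>i\<close> means
        \<open>i \<le> n * d \<le> i + 1\<close>, so \<open>i\<close> is the floor of
        \<open>n * d\<close> or one less.\<close>
      have sub: "{i \<in> {..<n}. real i / real n \<le> d \<and> d \<le> real (Suc i) / real n}
          \<subseteq> {nat \<lfloor>real n * d\<rfloor> - 1, nat \<lfloor>real n * d\<rfloor>}"
      proof
        fix i assume "i \<in> {i \<in> {..<n}. real i / real n \<le> d \<and> d \<le> real (Suc i) / real n}"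
        then have i: "i < n" "real i / real n \<le> d" "d \<le> real (Suc i) / real n" by auto
        have "real i \<le> real n * d" "real n * d \<le> real i + 1" using i by (auto simp: field_simps)
        then have "int i \<le> \<lfloor>real n * d\<rfloor>" "\<lfloor>real n * d\<rfloor> \<le> int i + 1" by linarith+
        then have "i = nat \<lfloor>real n * d\<rfloor> - 1 \<or> i = nat \<lfloor>real n * d\<rfloor>" by linarith
        then show "i \<in> {nat \<lfloor>real n * d\<rfloor> - 1, nat \<lfloor>real n * d\<rfloor>}" by simp
      qed
      have "(\<Sum>i<n. H i d) = real (card {i \<in> {..<n}. real i / real n \<le> d \<and> d \<le> real (Suc i) / real n})"
        unfolding H_def by (simp add: sum.If_cases Int_def)
      also have "\<dots> \<le> real (card {nat \<lfloor>real n * d\<rfloor> - 1, nat \<lfloor>real n * d\<rfloor>})"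
        using sub by (intro of_nat_mono card_mono) auto
      also have "\<dots> \<le> 2" by (simp add: card_insert_if)
      finally show ?thesis .
    qed
    have "(\<Sum>i<n. \<bar>\<sigma> (real (Suc i) / real n) - \<sigma> (real i / real n)\<bar>)
        \<le> (\<Sum>i<n. \<bar>L\<bar> / real n + 2 * B * (\<Sum>d\<in>D. H i d))"
      using cell by (intro sum_mono) auto
    also have "\<dots> = (\<Sum>i<n. \<bar>L\<bar> / real n) + 2 * B * (\<Sum>d\<in>D. \<Sum>i<n. H i d)"
      by (simp only: sum.distrib sum_distrib_left[symmetric] sum.swap[of _ D])
    also have "\<dots> \<le> \<bar>L\<bar> + 2 * B * (\<Sum>d\<in>D. 2)"
      using B cells by (intro add_mono mult_left_mono sum_mono) auto
    finally show "(\<Sum>i<n. \<bar>\<sigma> (real (Suc i) / real n) - \<sigma> (real i / real n)\<bar>) \<le> ?V"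
      by simp
  qed
qed

lemma summation_by_parts:
  fixes f x :: "nat \<Rightarrow> real"
  shows "(\<Sum>i\<in>{0<..k}. f i * x i) =
    f k * (\<Sum>i\<in>{0<..k}. x i) - (\<Sum>j<k. (f (Suc j) - f j) * (\<Sum>i\<in>{0<..j}. x i))"
proof (induction k)
  case (Suc k)
  have "{0<..Suc k} = insert (Suc k) {0<..k}" by auto
  then show ?case using Suc by (simp add: algebra_simps)
qed simp

text \<open>After summation by parts the boundary term costs \<open>B * m\<close> and the increments
  of \<open>f\<close> cost \<open>V * m\<close>.\<close>

lemma weighted_partial_sum_le:
  fixes f x :: "nat \<Rightarrow> real"
  assumes "k \<le> n" and m: "\<And>j. j \<le> n \<Longrightarrow> \<bar>\<Sum>i\<in>{0<..j}. x i\<bar> \<le> m"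
    and B: "\<And>j. j \<le> n \<Longrightarrow> \<bar>f j\<bar> \<le> B" and V: "(\<Sum>j<n. \<bar>f (Suc j) - f j\<bar>) \<le> V"
  shows "\<bar>\<Sum>i\<in>{0<..k}. f i * x i\<bar> \<le> (B + V) * m"
proof -
  have m0: "0 \<le> m" using m[of 0] by simp
  have B0: "0 \<le> B" using B[of 0] by linarith
  have "\<bar>f k * (\<Sum>i\<in>{0<..k}. x i)\<bar> \<le> B * m"
    unfolding abs_mult using assms B0 by (intro mult_mono) auto
  moreover have "\<bar>\<Sum>j<k. (f (Suc j) - f j) * (\<Sum>i\<in>{0<..j}. x i)\<bar> \<le> V * m"
  proof -
    have "\<bar>\<Sum>j<k. (f (Suc j) - f j) * (\<Sum>i\<in>{0<..j}. x i)\<bar>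
        \<le> (\<Sum>j<k. \<bar>f (Suc j) - f j\<bar> * \<bar>\<Sum>i\<in>{0<..j}. x i\<bar>)"
      unfolding abs_mult[symmetric] by (rule sum_abs)
    also have "\<dots> \<le> (\<Sum>j<k. \<bar>f (Suc j) - f j\<bar> * m)"
      using assms(1) by (intro sum_mono mult_left_mono m) auto
    also have "\<dots> \<le> (\<Sum>j<n. \<bar>f (Suc j) - f j\<bar> * m)"
      using assms(1) m0 by (intro sum_mono2) auto
    also have "\<dots> \<le> V * m"
      unfolding sum_distrib_right[symmetric] by (intro mult_right_mono V m0)
    finally show ?thesis .
  qed
  ultimately show ?thesis unfolding summation_by_parts by (simp add: algebra_simps)
qed

section \<open>The ratio statistic under bounded noise\<close>

lemma tau_hat_maximal:
  assumes "1 \<le> n"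
  shows "tau_hat y n \<in> {1..n} \<and> (\<forall>j\<in>{1..n}. ratio_stat y n j \<le> ratio_stat y n (tau_hat y n))"
proof -
  have "\<exists>k\<in>{1..n}. \<forall>j\<in>{1..n}. ratio_stat y n j \<le> ratio_stat y n k"
  proof -
    have "Max (ratio_stat y n ` {1..n}) \<in> ratio_stat y n ` {1..n}" using assms by (intro Max_in) auto
    then obtain k where "k \<in> {1..n}" "Max (ratio_stat y n ` {1..n}) = ratio_stat y n k" by auto
    moreover have "\<forall>j\<in>{1..n}. ratio_stat y n j \<le> Max (ratio_stat y n ` {1..n})" by auto
    ultimately show ?thesis by auto
  qed
  then show ?thesis unfolding tau_hat_def by (intro LeastI_ex[of "\<lambda>k. k \<in> {1..n} \<and> _ k"]) blast
qed

text \<open>A deterministic view of one outcome: \<open>z\<close> is the weighted noise,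
  \<open>\<Delta>\<close> the jump, and the noise enters the bounds only through
  \<open>w\<close>.\<close>

locale shifted_sample =
  fixes y z :: "nat \<Rightarrow> real" and \<mu> \<Delta> w :: real and n \<tau> :: nat
  assumes y: "\<And>i. y i = \<mu> + \<Delta> * (if \<tau> < i then 1 else 0) + z i"
    and \<tau>: "1 \<le> \<tau>" "\<tau> < n"
    and w: "\<And>k. k \<le> n \<Longrightarrow> \<bar>\<Sum>i\<in>{0<..k}. z i\<bar> \<le> w"
begin

definition P :: "nat \<Rightarrow> real" where "P k = (\<Sum>i=1..k. y i)"
definition W :: "nat \<Rightarrow> real" where "W k = (\<Sum>i\<in>{0<..k}. z i)"

definition num :: "nat \<Rightarrow> real" where
  "num k = \<bar>P k - real k * (P n / real n)\<bar> + \<bar>P n - P (n - k) - real k * (P n / real n)\<bar>"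

text \<open>Partial-sum bridges, each centred by the mean of its own segment: \<open>fwd k\<close>
  for the observations up to \<open>k\<close>, \<open>bwd k\<close> for the later ones, summed from
  the end.\<close>

definition fwd :: "nat \<Rightarrow> nat \<Rightarrow> real" where
  "fwd k i = P i - real i * (P k / real k)"
definition bwd :: "nat \<Rightarrow> nat \<Rightarrow> real" where
  "bwd k i = P n - P (i - 1) - (real n - real i + 1) * ((P n - P k) / (real n - real k))"

definition max_fwd :: "nat \<Rightarrow> real" where
  "max_fwd k = Max (insert 0 ((\<lambda>i. \<bar>fwd k i\<bar>) ` {1..k}))"
definition max_bwd :: "nat \<Rightarrow> real" where
  "max_bwd k = Max (insert 0 ((\<lambda>i. \<bar>bwd k i\<bar>) ` {k<..n}))"

lemma w_nonneg: "0 \<le> w"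
  using w[of 0] by simp

lemma n_pos: "0 < real n"
  using \<tau> by simp

lemma W_le: "k \<le> n \<Longrightarrow> \<bar>W k\<bar> \<le> w"
  unfolding W_def by (rule w)

text \<open>Truncated subtraction in \<open>k - \<tau>\<close> lets one formula cover both sides of
  the change point.\<close>

lemma P_eq: "P k = \<mu> * real k + \<Delta> * real (k - \<tau>) + W k"
proof (induction k)
  case (Suc k)
  have "{0<..Suc k} = insert (Suc k) {0<..k}" by auto
  then have "P (Suc k) = P k + y (Suc k)" "W (Suc k) = W k + z (Suc k)"
    by (simp_all add: P_def W_def)
  moreover have "real (Suc k - \<tau>) = real (k - \<tau>) + (if \<tau> < Suc k then 1 else 0)"
    by (auto simp: Suc_diff_le)
  ultimately show ?case using Suc y[of "Suc k"] by (simp only:) (simp add: algebra_simps)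
qed (simp add: P_def W_def)

lemma sum_y_tail:
  assumes "1 \<le> i" "i \<le> n + 1"
  shows "(\<Sum>j=i..n. y j) = P n - P (i - 1)"
proof -
  have "{1..n} = {1..i - 1} \<union> {i..n}" using assms by auto
  then have "P n = P (i - 1) + (\<Sum>j=i..n. y j)"
    unfolding P_def using assms by (simp add: sum.union_disjoint)
  then show ?thesis by simp
qed

lemma ratio_stat_eq:
  assumes k: "k \<in> {1..n}"
  shows "ratio_stat y n k = num k / (max_fwd k + max_bwd k)"
proof -
  have bm1: "blk_mean y 1 j = P j / real j" for j
    by (simp add: blk_mean_def P_def)
  \<comment> \<open>For \<open>k = n\<close> the later segment is empty and both sides are 0, as
    division by 0 gives 0.\<close>
  have bm2: "blk_mean y (k+1) n = (P n - P k) / (real n - real k)"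
    using sum_y_tail[of "k+1"] k by (simp add: blk_mean_def)
  have "(\<Sum>i=1..k. y i - blk_mean y 1 n) = P k - real k * (P n / real n)"
    unfolding bm1 by (simp add: sum_subtractf P_def)
  moreover have "(\<Sum>i=n-k+1..n. y i - blk_mean y 1 n) = P n - P (n - k) - real k * (P n / real n)"
    unfolding bm1 sum_subtractf using k by (subst sum_y_tail) (auto simp: of_nat_diff)
  moreover have "{\<bar>\<Sum>j=1..i. y j - blk_mean y 1 k\<bar> | i. i \<in> {1..k}} = (\<lambda>i. \<bar>fwd k i\<bar>) ` {1..k}"
    unfolding bm1 fwd_def sum_subtractf by (auto simp: P_def)
  moreover have "{\<bar>\<Sum>j=i..n. y j - blk_mean y (k+1) n\<bar> | i. i \<in> {k<..n}} = (\<lambda>i. \<bar>bwd k i\<bar>) ` {k<..n}"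
  proof -
    have "(\<Sum>j=i..n. y j - blk_mean y (k+1) n) = bwd k i" if "i \<in> {k<..n}" for i
      unfolding bm2 bwd_def sum_subtractf using that by (subst sum_y_tail) (auto simp: of_nat_diff)
    then show ?thesis by (auto simp del: sum_subtractf) metis
  qed
  ultimately show ?thesis
    unfolding ratio_stat_def num_def max_fwd_def max_bwd_def by simp
qed

section \<open>Bounds for the numerator and the denominator\<close>

lemma max_fwd_nonneg: "0 \<le> max_fwd k"
  unfolding max_fwd_def by (rule Max_ge) auto

lemma max_bwd_nonneg: "0 \<le> max_bwd k"
  unfolding max_bwd_def by (rule Max_ge) auto

lemma fwd_le_max: "i \<in> {1..k} \<Longrightarrow> \<bar>fwd k i\<bar> \<le> max_fwd k"
  unfolding max_fwd_def by (rule Max_ge) auto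

lemma bwd_le_max: "i \<in> {k<..n} \<Longrightarrow> \<bar>bwd k i\<bar> \<le> max_bwd k"
  unfolding max_bwd_def by (rule Max_ge) auto

lemma abs_diff_le: "\<bar>a\<bar> \<le> w \<Longrightarrow> \<bar>b\<bar> \<le> w \<Longrightarrow> \<bar>a - b\<bar> \<le> 2 * w"
  by linarith

lemma scaled_W_le:
  assumes "k \<le> n" "0 \<le> c" "c \<le> 1"
  shows "\<bar>c * W k\<bar> \<le> w"
proof -
  have "\<bar>c * W k\<bar> \<le> 1 * w"
    unfolding abs_mult using assms W_le w_nonneg by (intro mult_mono) auto
  then show ?thesis by simp
qed

definition signal :: "nat \<Rightarrow> real" where
  "signal k = real (k - \<tau>) - real k / real n * (real n - real \<tau>)"

lemma cusum_eq: "P k - real k * (P n / real n) = \<Delta> * signal k + (W k - real k / real n * W n)"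
  using n_pos \<tau> unfolding P_eq signal_def by (simp add: field_simps of_nat_diff)

lemma cusum_noise_le:
  assumes "k \<le> n"
  shows "\<bar>W k - real k / real n * W n\<bar> \<le> 2 * w"
proof -
  have "\<bar>real k / real n * W n\<bar> \<le> w" using assms n_pos by (intro scaled_W_le) auto
  with W_le[OF assms] show ?thesis by (rule abs_diff_le)
qed

text \<open>As a function of \<open>k\<close> the signal is a negative tent of depth
  \<open>\<tau> * (n - \<tau>) / n\<close>, attained at \<open>\<tau>\<close>; the crude bound
  \<open>n\<close> serves for the upper bound on the numerator.\<close>

lemma signal_le:
  assumes "k \<le> n"
  shows "\<bar>signal k\<bar> \<le> real n"
proof -
  have "real k / real n * (real n - real \<tau>) \<le> 1 * real n"
    using assms n_pos \<tau> by (intro mult_mono) auto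
  moreover have "0 \<le> real k / real n * (real n - real \<tau>)"
    using \<tau> by (intro mult_nonneg_nonneg) auto
  moreover have "0 \<le> real (k - \<tau>)" "real (k - \<tau>) \<le> real n" using assms by auto
  ultimately show ?thesis unfolding signal_def by linarith
qed

lemma cusum_le:
  assumes "k \<le> n"
  shows "\<bar>P k - real k * (P n / real n)\<bar> \<le> \<bar>\<Delta>\<bar> * real n + 2 * w"
proof -
  have "\<bar>\<Delta> * signal k\<bar> \<le> \<bar>\<Delta>\<bar> * real n"
    unfolding abs_mult using signal_le[OF assms] by (intro mult_left_mono) auto
  then show ?thesis unfolding cusum_eq using cusum_noise_le[OF assms] by linarith
qed

lemma num_le:
  assumes "k \<in> {1..n}"
  shows "num k \<le> 2 * (\<bar>\<Delta>\<bar> * real n + 2 * w)"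
proof -
  \<comment> \<open>The centred observations sum to 0, so the last \<open>k\<close> of them give
    minus the sum of the first \<open>n - k\<close>.\<close>
  have "P n - P (n - k) - real k * (P n / real n) = - (P (n - k) - real (n - k) * (P n / real n))"
  proof -
    have "real (n - k) * (P n / real n) = P n - real k * (P n / real n)"
      using assms n_pos by (simp add: of_nat_diff diff_divide_distrib left_diff_distrib)
    then show ?thesis by simp
  qed
  then have "\<bar>P n - P (n - k) - real k * (P n / real n)\<bar> \<le> \<bar>\<Delta>\<bar> * real n + 2 * w"
    using cusum_le[of "n - k"] by simp
  then show ?thesis unfolding num_def using cusum_le[of k] assms by simp
qed

lemma num_\<tau>_ge: "\<bar>\<Delta>\<bar> * (real \<tau> / real n * (real n - real \<tau>)) - 2 * w \<le> num \<tau>"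
proof -
  have "0 \<le> real \<tau> / real n * (real n - real \<tau>)" using \<tau> by (intro mult_nonneg_nonneg) auto
  then have "\<bar>\<Delta> * signal \<tau>\<bar> = \<bar>\<Delta>\<bar> * (real \<tau> / real n * (real n - real \<tau>))"
    using \<tau> by (simp add: abs_mult signal_def)
  moreover have "\<bar>W \<tau> - real \<tau> / real n * W n\<bar> \<le> 2 * w" using \<tau> by (intro cusum_noise_le) auto
  moreover have "t - 2 * w \<le> \<bar>a + b\<bar> + \<bar>d\<bar>" if "\<bar>a\<bar> = t" "\<bar>b\<bar> \<le> 2 * w" for a b d t :: real
    using that by linarith
  ultimately show ?thesis unfolding num_def cusum_eq by blast
qed

text \<open>Up to the true change the mean is constant and cancels in the bridge; two noise terms of
  size at most \<open>w\<close> remain.\<close>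

lemma max_fwd_\<tau>_le: "max_fwd \<tau> \<le> 2 * w"
proof -
  have "\<bar>fwd \<tau> i\<bar> \<le> 2 * w" if "i \<in> {1..\<tau>}" for i
  proof -
    have "fwd \<tau> i = W i - real i / real \<tau> * W \<tau>"
      using that \<tau> unfolding fwd_def P_eq by (simp add: field_simps)
    moreover have "\<bar>real i / real \<tau> * W \<tau>\<bar> \<le> w" using that \<tau> by (intro scaled_W_le) auto
    moreover have "\<bar>W i\<bar> \<le> w" using that \<tau> by (intro W_le) auto
    ultimately show ?thesis by (simp only: abs_diff_le)
  qed
  then show ?thesis unfolding max_fwd_def using w_nonneg by (intro Max.boundedI) auto
qed

text \<open>After the change the mean is again constant and cancels. A tail sum is a difference of
  two partial noise sums, hence four terms instead of two.\<close>

lemma max_bwd_\<tau>_le: "max_bwd \<tau> \<le> 4 * w"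
proof -
  have "\<bar>bwd \<tau> i\<bar> \<le> 4 * w" if i: "i \<in> {\<tau><..n}" for i
  proof -
    define c where "c = (real n - real i + 1) / (real n - real \<tau>)"
    have c: "0 \<le> c" "c \<le> 1" using i \<tau> unfolding c_def by (auto simp: field_simps)
    have Pn: "P n - P \<tau> = (\<mu> + \<Delta>) * (real n - real \<tau>) + (W n - W \<tau>)"
      using \<tau> unfolding P_eq by (simp add: of_nat_diff algebra_simps)
    have "i - 1 - \<tau> = i - Suc \<tau>" by simp
    then have Pi: "P n - P (i - 1) = (\<mu> + \<Delta>) * (real n - real i + 1) + (W n - W (i - 1))"
      using i \<tau> unfolding P_eq by (simp add: of_nat_diff algebra_simps)
    have "(real n - real i + 1) * ((P n - P \<tau>) / (real n - real \<tau>))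
        = (\<mu> + \<Delta>) * (real n - real i + 1) + c * (W n - W \<tau>)"
      unfolding Pn c_def using \<tau> by (simp add: field_simps)
    then have "bwd \<tau> i = W n - W (i - 1) - c * W n + c * W \<tau>"
      unfolding bwd_def Pi by (simp add: algebra_simps)
    moreover have "\<bar>W n\<bar> \<le> w" "\<bar>W (i - 1)\<bar> \<le> w" "\<bar>c * W n\<bar> \<le> w" "\<bar>c * W \<tau>\<bar> \<le> w"
      using W_le[of n] W_le[of "i - 1"] scaled_W_le[of n c] scaled_W_le[of \<tau> c] c i \<tau> by auto
    ultimately show ?thesis by linarith
  qed
  then show ?thesis unfolding max_bwd_def using w_nonneg by (intro Max.boundedI) auto
qed

text \<open>The bridge is evaluated at \<open>i = \<tau>\<close>: the mean of the first
  \<open>k\<close> observations includes shifted ones, which leaves a multiple of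
  \<open>\<Delta>\<close>. Replacing \<open>\<tau> / k\<close> by \<open>\<tau> / n\<close> makes
  the bound linear in \<open>k - \<tau>\<close>.\<close>

lemma max_fwd_ge:
  assumes k: "\<tau> < k" "k \<le> n"
  shows "\<bar>\<Delta>\<bar> * (real \<tau> / real n * (real k - real \<tau>)) - 2 * w \<le> max_fwd k"
proof -
  have eq: "fwd k \<tau> = W \<tau> - real \<tau> / real k * W k - \<Delta> * (real \<tau> / real k * (real k - real \<tau>))"
    using k unfolding fwd_def P_eq by (simp add: field_simps of_nat_diff)
  have "real \<tau> / real n * (real k - real \<tau>) \<le> real \<tau> / real k * (real k - real \<tau>)"
    using k \<tau> by (intro mult_right_mono frac_le) auto
  then have "\<bar>\<Delta>\<bar> * (real \<tau> / real n * (real k - real \<tau>)) \<le> \<bar>\<Delta>\<bar> * (real \<tau> / real k * (real k - real \<tau>))"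
    by (intro mult_left_mono) auto
  also have "\<dots> = \<bar>\<Delta> * (real \<tau> / real k * (real k - real \<tau>))\<bar>" using k by (simp add: abs_mult)
  also have "\<dots> \<le> \<bar>fwd k \<tau>\<bar> + 2 * w"
  proof -
    have "\<bar>real \<tau> / real k * W k\<bar> \<le> w" using k by (intro scaled_W_le) auto
    moreover have "\<bar>W \<tau>\<bar> \<le> w" using \<tau> by (intro W_le) auto
    moreover have "\<bar>t\<bar> \<le> \<bar>a - b - t\<bar> + 2 * w" if "\<bar>a\<bar> \<le> w" "\<bar>b\<bar> \<le> w" for a b t
      using that by linarith
    ultimately show ?thesis unfolding eq by blast
  qed
  finally show ?thesis using fwd_le_max[of \<tau> k] k \<tau> by auto
qed

text \<open>Mirror image of \<open>max_fwd_ge\<close>. The bridge is evaluated at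
  \<open>Suc \<tau>\<close>, from where on all observations are shifted.\<close>

lemma max_bwd_ge:
  assumes k: "k < \<tau>"
  shows "\<bar>\<Delta>\<bar> * ((real n - real \<tau>) / real n * (real \<tau> - real k)) - 4 * w \<le> max_bwd k"
proof -
  define c where "c = (real n - real \<tau>) / (real n - real k)"
  have c: "0 \<le> c" "c \<le> 1" using k \<tau> unfolding c_def by (auto simp: field_simps)
  have Pn: "P n - P k = \<mu> * (real n - real k) + \<Delta> * (real n - real \<tau>) + (W n - W k)"
    using \<tau> k unfolding P_eq by (simp add: of_nat_diff algebra_simps)
  have P\<tau>: "P n - P \<tau> = (\<mu> + \<Delta>) * (real n - real \<tau>) + (W n - W \<tau>)"
    using \<tau> unfolding P_eq by (simp add: of_nat_diff algebra_simps)
  have cB: "c * (real n - real k) = real n - real \<tau>" using k \<tau> by (simp add: c_def)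
  then have cA: "(real n - real \<tau>) - c * (real n - real \<tau>) = c * (real \<tau> - real k)"
    by (simp add: algebra_simps)
  have "bwd k (Suc \<tau>) = (P n - P \<tau>) - c * (P n - P k)" by (simp add: bwd_def c_def)
  also have "\<dots> = \<mu> * ((real n - real \<tau>) - c * (real n - real k))
      + \<Delta> * ((real n - real \<tau>) - c * (real n - real \<tau>)) + (W n - W \<tau> - c * W n + c * W k)"
    unfolding Pn P\<tau> by (simp add: algebra_simps)
  also have "\<dots> = \<Delta> * (c * (real \<tau> - real k)) + (W n - W \<tau> - c * W n + c * W k)"
    unfolding cA cB by simp
  finally have eq: "bwd k (Suc \<tau>) = \<Delta> * (c * (real \<tau> - real k)) + (W n - W \<tau> - c * W n + c * W k)" .
  have "(real n - real \<tau>) / real n * (real \<tau> - real k) \<le> c * (real \<tau> - real k)"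
    unfolding c_def using k \<tau> by (intro mult_right_mono frac_le) auto
  then have "\<bar>\<Delta>\<bar> * ((real n - real \<tau>) / real n * (real \<tau> - real k)) \<le> \<bar>\<Delta>\<bar> * (c * (real \<tau> - real k))"
    by (intro mult_left_mono) auto
  also have "\<dots> = \<bar>\<Delta> * (c * (real \<tau> - real k))\<bar>" using k c by (simp add: abs_mult)
  also have "\<dots> \<le> \<bar>bwd k (Suc \<tau>)\<bar> + 4 * w"
  proof -
    have "\<bar>W n\<bar> \<le> w" "\<bar>W \<tau>\<bar> \<le> w" "\<bar>c * W n\<bar> \<le> w" "\<bar>c * W k\<bar> \<le> w"
      using c k \<tau> by (auto intro!: W_le scaled_W_le)
    moreover have "\<bar>t\<bar> \<le> \<bar>t + (a - b - d + e)\<bar> + 4 * w"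
      if "\<bar>a\<bar> \<le> w" "\<bar>b\<bar> \<le> w" "\<bar>d\<bar> \<le> w" "\<bar>e\<bar> \<le> w" for a b d e t
      using that by linarith
    ultimately show ?thesis unfolding eq by blast
  qed
  finally show ?thesis using bwd_le_max[of "Suc \<tau>" k] k \<tau> by auto
qed

text \<open>Rules out a zero denominator at \<open>\<tau>\<close>. If all forward bridges vanish,
  then \<open>P\<close> is linear up to \<open>\<tau>\<close> and \<open>z\<close> is constant
  there, so it cannot take both signs.\<close>

lemma max_fwd_\<tau>_pos:
  assumes "i \<in> {1..\<tau>}" "z i < 0" and "j \<in> {1..\<tau>}" "0 < z j"
  shows "0 < max_fwd \<tau>"
proof (rule ccontr)
  assume "\<not> ?thesis"
  then have 0: "fwd \<tau> l = 0" if "l \<in> {1..\<tau>}" for l using fwd_le_max[OF that] by linarith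
  have z: "z l = P \<tau> / real \<tau> - \<mu>" if l: "l \<in> {1..\<tau>}" for l
  proof -
    have P: "P l' = real l' * (P \<tau> / real \<tau>)" if "l' \<le> \<tau>" for l'
      using 0[of l'] that by (cases "l' = 0") (auto simp: fwd_def P_def[of 0])
    obtain m where m: "l = Suc m" using l by (cases l) auto
    have "y l = P l - P m" unfolding m P_def by simp
    also have "\<dots> = P \<tau> / real \<tau>" using P[of l] P[of m] l unfolding m by (simp add: algebra_simps add_divide_distrib)
    finally show ?thesis using l by (simp add: y)
  qed
  from z[OF assms(1)] z[OF assms(3)] assms(2,4) show False by linarith
qed

text \<open>With numerators and denominators measured in units of
  \<open>\<bar>\<Delta>\<bar> * n\<close>, the quotient at \<open>k\<close> is at most
  \<open>(2 + 4 * \<eta>) / (c - 4 * \<eta>)\<close> and the one at \<open>\<tau>\<close> at least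
  \<open>(a * b - 2 * \<eta>) / (6 * \<eta>)\<close>; the last condition on \<eta> compares the two.
  Here \<open>c\<close> bounds from below the signal left in the denominator at distance
  \<open>e * n\<close>.\<close>

lemma ratio_stat_less:
  assumes \<Delta>: "\<Delta> \<noteq> 0"
    and a: "a * real n \<le> real \<tau>" "0 < a" and b: "b * real n \<le> real n - real \<tau>" "0 < b"
    and c: "0 < c" "c \<le> a * e" "c \<le> b * e"
    and \<eta>: "w = \<eta> * (\<bar>\<Delta>\<bar> * real n)" "4 * \<eta> < c" "(2 + 4 * \<eta>) * (6 * \<eta>) < (a * b - 2 * \<eta>) * (c - 4 * \<eta>)"
    and pos: "0 < max_fwd \<tau>"
    and k: "k \<in> {1..n}" "e * real n \<le> \<bar>real k - real \<tau>\<bar>"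
  shows "ratio_stat y n k < ratio_stat y n \<tau>"
proof -
  define s where "s = \<bar>\<Delta>\<bar> * real n"
  have s: "0 < s" using \<Delta> n_pos by (simp add: s_def)
  have ws: "w = \<eta> * s" using \<eta>(1) by (simp add: s_def)
  have \<eta>0: "0 \<le> \<eta>" using w_nonneg s unfolding ws by (simp add: zero_le_mult_iff)
  have numk: "num k \<le> (2 + 4 * \<eta>) * s" using num_le[OF k(1)] by (simp add: ws s_def algebra_simps)
  have num\<tau>: "(a * b - 2 * \<eta>) * s \<le> num \<tau>"
  proof -
    have "a * (b * real n) \<le> real \<tau> / real n * (real n - real \<tau>)"
      using a b n_pos by (intro mult_mono) (auto simp: field_simps)
    then have "\<bar>\<Delta>\<bar> * (a * (b * real n)) \<le> \<bar>\<Delta>\<bar> * (real \<tau> / real n * (real n - real \<tau>))"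
      by (intro mult_left_mono) auto
    then show ?thesis using num_\<tau>_ge by (simp add: ws s_def algebra_simps)
  qed
  have e0: "0 < e" using c a(2) by (smt (verit) zero_less_mult_pos)
  have denk: "(c - 4 * \<eta>) * s \<le> max_fwd k + max_bwd k"
  proof -
    have cn: "\<bar>\<Delta>\<bar> * (d * (e * real n)) \<ge> c * s" if "c \<le> d * e" for d
      using mult_right_mono[OF that, of s] s by (simp add: s_def mult_ac)
    have "k \<noteq> \<tau>" using k(2) e0 n_pos by (smt (verit) mult_pos_pos)
    then consider "\<tau> < k" | "k < \<tau>" by linarith
    then show ?thesis
    proof cases
      case 1
      have "a * (e * real n) \<le> real \<tau> / real n * (real k - real \<tau>)"
        using a e0 k(2) 1 n_pos by (intro mult_mono) (auto simp: field_simps)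
      then have "\<bar>\<Delta>\<bar> * (a * (e * real n)) \<le> \<bar>\<Delta>\<bar> * (real \<tau> / real n * (real k - real \<tau>))"
        by (intro mult_left_mono) auto
      then have "c * s - 2 * w \<le> max_fwd k" using max_fwd_ge[OF 1] cn[OF c(2)] k(1) by auto
      then show ?thesis using max_bwd_nonneg[of k] w_nonneg unfolding left_diff_distrib ws by linarith
    next
      case 2
      have "b * (e * real n) \<le> (real n - real \<tau>) / real n * (real \<tau> - real k)"
        using b e0 k(2) 2 n_pos \<tau> by (intro mult_mono) (auto simp: field_simps)
      then have "\<bar>\<Delta>\<bar> * (b * (e * real n)) \<le> \<bar>\<Delta>\<bar> * ((real n - real \<tau>) / real n * (real \<tau> - real k))"
        by (intro mult_left_mono) auto
      then have "c * s - 4 * w \<le> max_bwd k" using max_bwd_ge[OF 2] cn[OF c(3)] by auto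
      then show ?thesis using max_fwd_nonneg[of k] unfolding left_diff_distrib ws by linarith
    qed
  qed
  have den\<tau>: "0 < max_fwd \<tau> + max_bwd \<tau>" "max_fwd \<tau> + max_bwd \<tau> \<le> 6 * \<eta> * s"
    using pos max_bwd_nonneg[of \<tau>] max_fwd_\<tau>_le max_bwd_\<tau>_le by (auto simp: ws)
  then have \<eta>pos: "0 < \<eta>" using s by (smt (verit) mult_pos_pos zero_less_mult_pos2)
  have cpos: "0 < c - 4 * \<eta>" using \<eta>(2) by simp
  have abpos: "0 < a * b - 2 * \<eta>"
  proof -
    have "0 < (2 + 4 * \<eta>) * (6 * \<eta>)" using \<eta>pos by simp
    then have "0 < (a * b - 2 * \<eta>) * (c - 4 * \<eta>)" using \<eta>(3) by linarith
    then show ?thesis using cpos by (simp add: zero_less_mult_iff)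
  qed
  have "ratio_stat y n k = num k / (max_fwd k + max_bwd k)" using k(1) by (rule ratio_stat_eq)
  also have "\<dots> \<le> ((2 + 4 * \<eta>) * s) / ((c - 4 * \<eta>) * s)"
    using numk denk cpos s \<eta>pos by (intro frac_le) auto
  also have "\<dots> = (2 + 4 * \<eta>) / (c - 4 * \<eta>)" using s by simp
  also have "\<dots> < (a * b - 2 * \<eta>) / (6 * \<eta>)" using \<eta>(3) cpos \<eta>pos by (simp add: divide_simps mult.commute)
  also have "\<dots> = ((a * b - 2 * \<eta>) * s) / (6 * \<eta> * s)" using s by simp
  also have "\<dots> \<le> num \<tau> / (max_fwd \<tau> + max_bwd \<tau>)"
  proof (intro frac_le num\<tau> den\<tau>)
    have "0 < (a * b - 2 * \<eta>) * s" using abpos s by simp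
    then show "0 \<le> num \<tau>" using num\<tau> by linarith
  qed
  also have "\<dots> = ratio_stat y n \<tau>" using \<tau> by (intro ratio_stat_eq[symmetric]) auto
  finally show ?thesis .
qed

lemma tau_hat_close:
  assumes \<Delta>: "\<Delta> \<noteq> 0"
    and a: "a * real n \<le> real \<tau>" "0 < a" and b: "b * real n \<le> real n - real \<tau>" "0 < b"
    and c: "0 < c" "c \<le> a * e" "c \<le> b * e"
    and \<eta>: "w = \<eta> * (\<bar>\<Delta>\<bar> * real n)" "4 * \<eta> < c" "(2 + 4 * \<eta>) * (6 * \<eta>) < (a * b - 2 * \<eta>) * (c - 4 * \<eta>)"
    and pos: "0 < max_fwd \<tau>"
  shows "\<bar>real (tau_hat y n) - real \<tau>\<bar> < e * real n"
proof (rule ccontr)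
  assume "\<not> ?thesis"
  then have far: "e * real n \<le> \<bar>real (tau_hat y n) - real \<tau>\<bar>" by simp
  have max: "tau_hat y n \<in> {1..n}" "\<forall>j\<in>{1..n}. ratio_stat y n j \<le> ratio_stat y n (tau_hat y n)"
    using tau_hat_maximal[of n y] \<tau> by auto
  have "ratio_stat y n (tau_hat y n) < ratio_stat y n \<tau>"
    using assms max(1) far by (rule ratio_stat_less)
  moreover have "\<tau> \<in> {1..n}" using \<tau> by simp
  ultimately show False using max(2) by (meson not_less)
qed

end

section \<open>Consistency of the estimator\<close>

text \<open>As \<eta> tends to 0, the left side of the last inequality vanishes while the right side
  tends to \<open>a * b * c\<close>. For \<open>\<eta> = a * b * c / 60\<close> the left side is at
  most 3/10 and the right side at least (29/30) (14/15) times \<open>a * b * c\<close>.\<close>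

lemma small_noise_level_exists:
  fixes a b c :: real
  assumes "0 < a" "a \<le> 1" "0 < b" "b \<le> 1" "0 < c" "c \<le> 1"
  obtains \<eta> where "0 < \<eta>" "4 * \<eta> < c" "(2 + 4 * \<eta>) * (6 * \<eta>) < (a * b - 2 * \<eta>) * (c - 4 * \<eta>)"
proof
  let ?h = "a * b"
  let ?\<eta> = "?h * c / 60"
  have h: "0 < ?h" "?h \<le> 1" using assms by (auto intro: mult_le_one)
  have hc: "0 < ?h * c" "?h * c \<le> ?h" "?h * c \<le> c"
    using h assms mult_left_mono[of c 1 ?h] mult_right_mono[of ?h 1 c] by auto
  show "0 < ?\<eta>" using hc by simp
  show "4 * ?\<eta> < c" using hc assms by linarith
  have "(2 + 4 * ?\<eta>) * (6 * ?\<eta>) \<le> 3 * (6 * ?\<eta>)"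
    using hc h by (intro mult_right_mono) linarith+
  also have "\<dots> < (29/30 * ?h) * (14/15 * c)" using hc by simp
  also have "\<dots> \<le> (?h - 2 * ?\<eta>) * (c - 4 * ?\<eta>)"
    using hc h assms by (intro mult_mono) linarith+
  finally show "(2 + 4 * ?\<eta>) * (6 * ?\<eta>) < (?h - 2 * ?\<eta>) * (c - 4 * ?\<eta>)" .
qed

theorem theorem4:
  fixes M :: "'a measure" and \<epsilon> :: "nat \<Rightarrow> 'a \<Rightarrow> real"
    and \<mu> :: real and \<delta> :: "nat \<Rightarrow> real" and \<sigma> :: "real \<Rightarrow> real" and \<zeta> :: real
  assumes "prob_space M"
    and "assumption_E M \<epsilon>"
    and "assumption_V \<sigma>"
    and "filterlim (\<lambda>n. \<bar>\<delta> n\<bar> * sqrt (real n)) at_top sequentially"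
    and "0 < \<zeta>" and "\<zeta> < 1"
    and "\<forall>n. \<delta> n \<noteq> 0"
  shows "\<forall>e>0. (\<lambda>n. measure M {\<omega> \<in> space M.
            \<bar>real (tau_hat (\<lambda>k. obsY \<mu> \<delta> (\<lambda>m. nat \<lfloor>real m * \<zeta>\<rfloor>) \<sigma> \<epsilon> n k \<omega>) n) / real n - \<zeta>\<bar> > e})
           \<longlonglongrightarrow> 0"
proof (intro allI impI)
  fix e :: real
  assume e: "0 < e"
  note \<zeta> = assms(5,6)
  interpret prob_space M by fact
  have meas: "\<And>k. 1 \<le> k \<Longrightarrow> \<epsilon> k \<in> borel_measurable M" and stat: "strictly_stationary M \<epsilon>"
    and int1: "integrable M (\<epsilon> 1)" and mean: "expectation (\<epsilon> 1) = 0" and var: "variance (\<epsilon> 1) = 1"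
    and sq: "integrable M (\<lambda>\<omega>. (\<epsilon> 1 \<omega>)\<^sup>2)"
    and sumcov: "summable (\<lambda>n. expectation (\<lambda>\<omega>. \<epsilon> 1 \<omega> * \<epsilon> (n + 2) \<omega>))"
    using assms(2) unfolding assumption_E_def by auto
  interpret stationary_process M \<epsilon> by unfold_locales (use meas stat in auto)
  obtain p r where p: "2 < p" "integrable M (\<lambda>\<omega>. \<bar>\<epsilon> 1 \<omega>\<bar> powr p)" and r: "2 < r" "r \<le> p"
    and sum\<alpha>: "summable (\<lambda>n. rpow (\<alpha> (Suc n)) (2 * (1/r - 1/p)))"
    using assms(2) unfolding assumption_E_def by auto
  define s where "s = 2 * (1/r - 1/p)"
  \<comment> \<open>With exponent 0 the convention of \<open>rpow\<close> makes every summand 1, so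
    the series would diverge.\<close>
  have "s \<noteq> 0"
  proof
    assume "s = 0"
    then show False using sum\<alpha> by (simp add: s_def rpow_def summable_const_iff)
  qed
  moreover have "0 \<le> s" using r by (simp add: s_def frac_le)
  ultimately have s0: "0 < s" by simp
  have "1 / r < 1 / 2" using r(1) by simp
  then have s1: "s < 1 - 2 / p" by (simp add: s_def)
  have "summable (\<lambda>n. \<alpha> (Suc n) powr s)" using sum\<alpha> \<open>s \<noteq> 0\<close> unfolding s_def[symmetric] rpow_def by simp
  then obtain A where A: "0 \<le> A" "\<And>n. 1 \<le> n \<Longrightarrow> \<alpha> n \<le> A * real n powr (- 1 / s)"
    using decseq_summable_powr_bound[of \<alpha> s, OF alpha_nonneg decseq_alpha s0] by auto
  have "- 1 / s < 0" using s0 by simp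
  then have "(\<lambda>n. A * real n powr (- 1 / s)) \<longlonglongrightarrow> A * 0"
    by (intro tendsto_mult tendsto_const tendsto_neg_powr filterlim_real_sequentially)
  then have A0: "(\<lambda>n. A * real n powr (- 1 / s)) \<longlonglongrightarrow> 0" by (simp only: mult_zero_right)
  have \<alpha>0: "\<alpha> \<longlonglongrightarrow> 0"
  proof (rule real_tendsto_sandwich[OF _ _ tendsto_const A0])
    show "\<forall>\<^sub>F n in sequentially. 0 \<le> \<alpha> n" by (simp only: alpha_nonneg eventually_True)
    show "\<forall>\<^sub>F n in sequentially. \<alpha> n \<le> A * real n powr (- 1 / s)"
      by (rule eventually_sequentiallyI[OF A(2)])
  qed
  have "Bseq (\<lambda>n. \<Sum>h<n. expectation (\<lambda>\<omega>. \<epsilon> 1 \<omega> * \<epsilon> (h + 2) \<omega>))"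
    using sumcov by (intro convergent_imp_Bseq) (simp add: summable_iff_convergent)
  then obtain K where K: "\<And>n. \<bar>\<Sum>h<n. expectation (\<lambda>\<omega>. \<epsilon> 1 \<omega> * \<epsilon> (h + 2) \<omega>)\<bar> \<le> K"
    unfolding Bseq_def by auto
  obtain B where B: "0 \<le> B" "\<And>x. x \<in> {0..1} \<Longrightarrow> \<bar>\<sigma> x\<bar> \<le> B"
    using assumption_V_bounded[OF assms(3)] by blast
  obtain V where V: "0 \<le> V"
    "\<And>n. (\<Sum>i<n. \<bar>\<sigma> (real (Suc i) / real n) - \<sigma> (real i / real n)\<bar>) \<le> V"
    using assumption_V_variation[OF assms(3)] by blast
  define C where "C = B + V + 1"
  have C: "0 < C" "B + V \<le> C" using B V by (simp_all add: C_def)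
  have \<sigma>pos: "0 < \<sigma> x" if "x \<in> {0..1}" for x using assms(3) that by (auto simp: assumption_V_def)
  \<comment> \<open>Once \<open>n * \<zeta> \<ge> 2\<close>, rounding down still leaves
    \<open>\<tau> n \<ge> n * \<zeta> / 2\<close>, and always
    \<open>n - \<tau> n \<ge> (1 - \<zeta>) * n\<close>. Half of \<open>e\<close> is kept for the
    rounding error in \<open>\<tau> n\<close>; the cap 1 keeps \<open>d\<close> at most 1.\<close>
  define a b e' where "a = \<zeta> / 2" and "b = 1 - \<zeta>" and "e' = min (e / 2) 1"
  define d where "d = min a b * e'"
  have e': "0 < e'" "e' \<le> 1" "e' \<le> e / 2" using e by (auto simp: e'_def)
  have ab: "0 < a" "a \<le> 1" "0 < b" "b \<le> 1" using \<zeta> by (auto simp: a_def b_def)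
  have d: "0 < d" "d \<le> 1" "d \<le> a * e'" "d \<le> b * e'"
    using e' ab by (auto simp: d_def intro: mult_le_one mult_right_mono)
  obtain \<eta> where \<eta>: "0 < \<eta>" "4 * \<eta> < d" "(2 + 4 * \<eta>) * (6 * \<eta>) < (a * b - 2 * \<eta>) * (d - 4 * \<eta>)"
    using small_noise_level_exists ab d by metis
  \<comment> \<open>Scaled so that \<open>C * (c n * sqrt (real n))\<close> is the noise level
    \<open>w\<close> used below; it diverges because
    \<open>\<bar>\<delta> n\<bar> * sqrt (real n)\<close> does.\<close>
  define c where "c n = \<eta> / C * (\<bar>\<delta> n\<bar> * sqrt (real n))" for n
  have c: "filterlim c at_top sequentially"
    unfolding c_def using \<eta>(1) C(1)
    by (intro filterlim_tendsto_pos_mult_at_top[OF tendsto_const _ assms(4)]) auto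
  define \<tau> where "\<tau> m = nat \<lfloor>real m * \<zeta>\<rfloor>" for m
  \<comment> \<open>Exceptional events: \<open>E n\<close> for large partial sums, and
    \<open>R B n\<close> with a closed half-line \<open>B\<close> for errors that all have one weak
    sign before the change.\<close>
  define E where "E n = {\<omega> \<in> space M. \<exists>k\<le>n. c n * sqrt (real n) < \<bar>block_sum 0 k \<omega>\<bar>}" for n
  define R where "R B n = {\<omega> \<in> space M. \<forall>i\<in>{1..\<tau> n}. \<epsilon> i \<omega> \<in> B}" for B n
  let ?bad = "\<lambda>n. {\<omega> \<in> space M.
            \<bar>real (tau_hat (\<lambda>k. obsY \<mu> \<delta> \<tau> \<sigma> \<epsilon> n k \<omega>) n) / real n - \<zeta>\<bar> > e}"
  have Elim: "(\<lambda>n. prob (E n)) \<longlonglongrightarrow> 0"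
    unfolding E_def using sq K p s0 s1 A c by (rule prob_max_partial_sum_tendsto_0)
  have \<tau>lim: "filterlim \<tau> at_top sequentially"
    unfolding filterlim_at_top
  proof
    fix Z :: nat
    show "\<forall>\<^sub>F n in sequentially. Z \<le> \<tau> n"
    proof (rule eventually_sequentiallyI[of "nat \<lceil>real Z / \<zeta>\<rceil>"])
      fix n assume "nat \<lceil>real Z / \<zeta>\<rceil> \<le> n"
      then have "real Z / \<zeta> \<le> real n" by linarith
      then have "real Z \<le> real n * \<zeta>" using \<zeta> by (simp add: field_simps)
      then show "Z \<le> \<tau> n" unfolding \<tau>_def by (rule le_nat_floor)
    qed
  qed
  have Rlim: "(\<lambda>n. prob (R B n)) \<longlonglongrightarrow> 0" if "B \<in> sets borel" "prob {\<omega> \<in> space M. \<epsilon> 1 \<omega> \<in> B} < 1" for B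
    unfolding R_def using filterlim_compose[OF prob_run_tendsto_0[OF that \<alpha>0] \<tau>lim] .
  have "prob {\<omega> \<in> space M. \<epsilon> 1 \<omega> \<in> {0..}} < 1" "prob {\<omega> \<in> space M. \<epsilon> 1 \<omega> \<in> {..0}} < 1"
    using prob_lt_1_of_nondegenerate[OF int1 mean var] by simp_all
  then have Rlims: "(\<lambda>n. prob (R {0..} n)) \<longlonglongrightarrow> 0" "(\<lambda>n. prob (R {..0} n)) \<longlonglongrightarrow> 0"
    by (auto intro!: Rlim)
  \<comment> \<open>Outside the exceptional events the sample meets the hypotheses of
    \<open>tau_hat_close\<close>. The conditions on \<open>n\<close> say
    \<open>n * \<zeta> \<ge> 2\<close> and \<open>n * e \<ge> 2\<close>, which absorbs the
    rounding.\<close>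
  have close: "\<bar>real (tau_hat (\<lambda>k. obsY \<mu> \<delta> \<tau> \<sigma> \<epsilon> n k \<omega>) n) / real n - \<zeta>\<bar> \<le> e"
    if n: "2 / \<zeta> \<le> real n" "2 / e \<le> real n"
      and \<omega>: "\<omega> \<in> space M" "\<omega> \<notin> E n" "\<omega> \<notin> R {0..} n" "\<omega> \<notin> R {..0} n" for n \<omega>
  proof -
    let ?y = "\<lambda>k. obsY \<mu> \<delta> \<tau> \<sigma> \<epsilon> n k \<omega>"
    let ?z = "\<lambda>k. \<sigma> (real k / real n) * \<epsilon> k \<omega>"
    define w where "w = \<eta> * (\<bar>\<delta> n\<bar> * real n)"
    have n\<zeta>: "2 \<le> real n * \<zeta>" and ne: "2 \<le> real n * e" using n \<zeta> e by (simp_all add: field_simps)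
    have n0: "0 < real n" using n(1) \<zeta> by (smt (verit) divide_pos_pos)
    have "real n * \<zeta> < real n" using n0 \<zeta> by simp
    have \<tau>r: "real (\<tau> n) = of_int \<lfloor>real n * \<zeta>\<rfloor>" using n\<zeta> by (simp add: \<tau>_def)
    have tb: "real (\<tau> n) \<le> real n * \<zeta>" "real n * \<zeta> < real (\<tau> n) + 1" unfolding \<tau>r by linarith+
    have \<tau>n: "\<tau> n < n" using tb \<open>real n * \<zeta> < real n\<close> by linarith
    interpret shifted_sample ?y ?z \<mu> "\<delta> n" w n "\<tau> n"
    proof
      show "?y i = \<mu> + \<delta> n * (if \<tau> n < i then 1 else 0) + ?z i" for i
        by (simp add: obsY_def)
      show "1 \<le> \<tau> n" using tb n\<zeta> by linarith
      show "\<tau> n < n" by (rule \<tau>n)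
      fix k assume k: "k \<le> n"
      have cn: "0 \<le> c n" using \<eta> C by (simp add: c_def)
      have "\<bar>\<Sum>i\<in>{0<..k}. ?z i\<bar> \<le> (B + V) * (c n * sqrt (real n))"
      proof (rule weighted_partial_sum_le[OF k])
        show "\<bar>\<Sum>i\<in>{0<..j}. \<epsilon> i \<omega>\<bar> \<le> c n * sqrt (real n)" if "j \<le> n" for j
          using \<omega>(1,2) that by (auto simp: E_def not_less)
        show "\<bar>\<sigma> (real j / real n)\<bar> \<le> B" if "j \<le> n" for j
          using that n0 by (intro B) (auto simp: field_simps)
      qed (rule V)
      also have "\<dots> \<le> C * (c n * sqrt (real n))" using C cn by (intro mult_right_mono) auto
      also have "\<dots> = w" using C by (simp add: c_def w_def)
      finally show "\<bar>\<Sum>i\<in>{0<..k}. ?z i\<bar> \<le> w" .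
    qed
    have \<sigma>i: "0 < \<sigma> (real i / real n)" if "i \<in> {1..\<tau> n}" for i
      using that n0 \<tau>n by (intro \<sigma>pos) (auto simp: field_simps)
    obtain i where i: "i \<in> {1..\<tau> n}" "\<epsilon> i \<omega> < 0" using \<omega>(1,3) by (auto simp: R_def not_le)
    obtain j where j: "j \<in> {1..\<tau> n}" "0 < \<epsilon> j \<omega>" using \<omega>(1,4) by (auto simp: R_def not_le)
    \<comment> \<open>As \<sigma> is positive, the weighted errors inherit the signs of the
      errors.\<close>
    have "0 < max_fwd (\<tau> n)"
      using i(1) _ j(1) by (rule max_fwd_\<tau>_pos) (use \<sigma>i i j in \<open>auto simp: mult_pos_neg\<close>)
    moreover have "a * real n \<le> real (\<tau> n)" "b * real n \<le> real n - real (\<tau> n)"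
      using tb n\<zeta> by (auto simp: a_def b_def algebra_simps)
    ultimately have "\<bar>real (tau_hat ?y n) - real (\<tau> n)\<bar> < e' * real n"
      using assms(7) ab d \<eta> by (intro tau_hat_close[of a b d e' \<eta>]) (auto simp: w_def)
    also have "\<dots> \<le> real n * e / 2" using mult_right_mono[OF e'(3), of "real n"] n0 by (simp add: mult.commute)
    finally have "\<bar>real (tau_hat ?y n) - real (\<tau> n)\<bar> < real n * e / 2" .
    \<comment> \<open>Rounding moves the change point by less than 1, which is at most
      \<open>l / 2\<close>.\<close>
    moreover have "\<bar>t - x\<bar> \<le> l" if "\<bar>t - r\<bar> < l / 2" "r \<le> x" "x < r + 1" "2 \<le> l" for t x r l :: real
      using that by linarith
    ultimately have "\<bar>real (tau_hat ?y n) - real n * \<zeta>\<bar> \<le> real n * e" using tb ne by blast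
    moreover have "real (tau_hat ?y n) / real n - \<zeta> = (real (tau_hat ?y n) - real n * \<zeta>) / real n"
      using n0 by (simp add: field_simps)
    ultimately show ?thesis using n0 by (simp add: field_simps)
  qed
  have upper: "\<forall>\<^sub>F n in sequentially. prob (?bad n) \<le> prob (E n) + prob (R {0..} n) + prob (R {..0} n)"
  proof (rule eventually_sequentiallyI)
    fix n assume "max (nat \<lceil>2 / \<zeta>\<rceil>) (nat \<lceil>2 / e\<rceil>) \<le> n"
    then have n: "2 / \<zeta> \<le> real n" "2 / e \<le> real n" by linarith+
    have Em: "E n \<in> events"
    proof -
      have "E n = (\<Union>k\<in>{..n}. {\<omega> \<in> space M. c n * sqrt (real n) < \<bar>block_sum 0 k \<omega>\<bar>})"
        by (auto simp: E_def)
      also have "\<dots> \<in> events" by (intro sets.finite_UN) auto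
      finally show ?thesis .
    qed
    have Rm: "R B n \<in> events" if [measurable]: "B \<in> sets borel" for B
      unfolding R_def
    proof (rule sets.sets_Collect_finite_All)
      fix i assume "i \<in> {1..\<tau> n}"
      then have [measurable]: "\<epsilon> i \<in> borel_measurable M" by (intro measurable_X) auto
      show "{\<omega> \<in> space M. \<epsilon> i \<omega> \<in> B} \<in> events" by measurable
    qed auto
    have "prob (?bad n) \<le> prob (E n \<union> R {0..} n \<union> R {..0} n)"
      using close[OF n] Em Rm[of "{0..}"] Rm[of "{..0}"] by (intro finite_measure_mono) (auto simp: not_less[symmetric])
    also have "\<dots> \<le> prob (E n \<union> R {0..} n) + prob (R {..0} n)"
      using Em Rm[of "{0..}"] Rm[of "{..0}"] by (intro measure_Un_le) auto
    also have "\<dots> \<le> prob (E n) + prob (R {0..} n) + prob (R {..0} n)"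
      using Em Rm[of "{0..}"] by (intro add_right_mono measure_Un_le) auto
    finally show "prob (?bad n) \<le> prob (E n) + prob (R {0..} n) + prob (R {..0} n)" .
  qed
  have "(\<lambda>n. prob (E n) + prob (R {0..} n) + prob (R {..0} n)) \<longlonglongrightarrow> 0 + 0 + 0"
    by (intro tendsto_add Elim Rlims)
  then have lim: "(\<lambda>n. prob (E n) + prob (R {0..} n) + prob (R {..0} n)) \<longlonglongrightarrow> 0"
    by (simp only: add_0_right)
  have "\<forall>\<^sub>F n in sequentially. 0 \<le> prob (?bad n)"
    by (rule always_eventually) (rule allI, rule measure_nonneg)
  from this upper tendsto_const lim have "(\<lambda>n. prob (?bad n)) \<longlonglongrightarrow> 0"
    by (rule real_tendsto_sandwich)
  moreover have "\<tau> = (\<lambda>m. nat \<lfloor>real m * \<zeta>\<rfloor>)" unfolding \<tau>_def ..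
  ultimately show "(\<lambda>n. measure M {\<omega> \<in> space M.
            \<bar>real (tau_hat (\<lambda>k. obsY \<mu> \<delta> (\<lambda>m. nat \<lfloor>real m * \<zeta>\<rfloor>) \<sigma> \<epsilon> n k \<omega>) n) / real n - \<zeta>\<bar> > e})
           \<longlonglongrightarrow> 0"
    by (simp only:)
qed

end
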